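(* Let $0<p<1$ and let $D_n$ be the degree of the source in a random series-parallel network of size $n$ generated by the saturation model with parameter $p$. (i) If $0<p\le\frac12$, then $D_n\xrightarrow{(d)}D$ as $n\to\infty$, where \[ \mathbb{P}\{D=m\}=\frac{1}{m+1}\binom{2m}{m}p^{m-1}(1-p)^{m+1},\quad m\ge1 . \] (ii) If $\frac12<p<1$, then as $n\to\infty$ \[ \frac{(2p-1)^2}{p^2}\cdot\frac{D_n}{n^{2p-1}}\xrightarrow{(d)}D,\qquad D\stackrel{(d)}{=}B\cdot Y, \] where $B$ is Bernoulli$\big(\frac{2p-1}{p^2}\big)$ distributed and $Y$ is Mittag-Leffler$(2p-1)$ distributed, independent of $B$.
   Context: Saturation model (parameter $0<p<1$): a series-parallel network is a directed multigraph with a source and a sink; its size is its number of edges, labelled in order of creation. At step $1$ it is a single edge (label $1$) from source to sink. At step $n\ge2$ an existing edge $j=(x,y)$ is selected, where the probability of selecting edge $j$ is proportional to $2-\ell_j$, with $\ell_j\in\{0,1,2\}$ the number of earlier steps at which edge $j$ was selected (so each edge is selected at most twice); then, independently, with probability $p$ a new edge $(x,y)$ (label $n$) is added in parallel, and with probability $1-p$ edge $j$ is replaced by $(x,z)$ (keeping label $j$) and $(z,y)$ (label $n$), with $z$ a new node. Bernoulli$(q)$ takes value $1$ with probability $q$ and $0$ otherwise. Mittag-Leffler$(\alpha)$ ($0<\alpha<1$) is the distribution with $r$-th moments $r!/\Gamma(r\alpha+1)$, $r\ge0$. *)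

theory Defs
  imports "HOL-Probability.Probability" "Graph_Theory.Digraph"
begin

definition proportional_pmf :: "'a set \<Rightarrow> ('a \<Rightarrow> real) \<Rightarrow> 'a pmf" where
  "proportional_pmf A w = embed_pmf (\<lambda>x. if x \<in> A then w x / sum w A else 0)"

lemma pmf_proportional_pmf:
  assumes "finite A" "\<And>x. x \<in> A \<Longrightarrow> 0 \<le> w x" "0 < sum w A"
  shows "pmf (proportional_pmf A w) x = (if x \<in> A then w x / sum w A else 0)"
proof -
  let ?f = "\<lambda>x. if x \<in> A then w x / sum w A else 0"
  have nn: "0 \<le> ?f x" for x
    using assms by simp
  have "(\<integral>\<^sup>+x. ennreal (?f x) \<partial>count_space UNIV) = (\<Sum>x\<in>A. ennreal (?f x))"
    using assms(1) by (intro nn_integral_count_space') auto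
  also have "\<dots> = ennreal (\<Sum>x\<in>A. ?f x)"
    using nn by (rule sum_ennreal)
  also have "(\<Sum>x\<in>A. ?f x) = (\<Sum>x\<in>A. w x / sum w A)"
    by (rule sum.cong) auto
  also have "\<dots> = 1"
    using assms(3) by (simp flip: sum_divide_distrib)
  finally show ?thesis
    unfolding proportional_pmf_def using nn by (subst pmf_embed_pmf) auto
qed

text \<open>
  The arcs of a network are its edge labels. The source is the node 0, the sink is the node 1, and
  a node created at step n (necessarily n \<open>\<ge>\<close> 2) is called n, so that it is always new.
  The field \<open>selections\<close> counts how often each edge has been selected so far.
\<close>

record network =
  graph :: "(nat, nat) pre_digraph"
  selections :: "nat \<Rightarrow> nat"

definition source :: nat where "source = 0"

definition sink :: nat where "sink = 1"

definition single_edge :: network where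
  "single_edge =
     \<lparr> graph = \<lparr> verts = {source, sink}, arcs = {1}, tail = (\<lambda>_. source), head = (\<lambda>_. sink) \<rparr>,
       selections = (\<lambda>_. 0) \<rparr>"

definition add_parallel :: "nat \<Rightarrow> nat \<Rightarrow> (nat, nat) pre_digraph \<Rightarrow> (nat, nat) pre_digraph" where
  "add_parallel n j G =
     \<lparr> verts = verts G, arcs = insert n (arcs G),
       tail = (tail G)(n := tail G j), head = (head G)(n := head G j) \<rparr>"

definition subdivide :: "nat \<Rightarrow> nat \<Rightarrow> (nat, nat) pre_digraph \<Rightarrow> (nat, nat) pre_digraph" where
  "subdivide n j G =
     \<lparr> verts = insert n (verts G), arcs = insert n (arcs G),
       tail = (tail G)(n := n), head = (head G)(j := n, n := head G j) \<rparr>"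

definition saturation_step :: "real \<Rightarrow> nat \<Rightarrow> network \<Rightarrow> network pmf" where
  "saturation_step p n N =
     bind_pmf (proportional_pmf (arcs (graph N)) (\<lambda>j. 2 - real (selections N j))) (\<lambda>j.
     bind_pmf (bernoulli_pmf p) (\<lambda>b.
     return_pmf
       \<lparr> graph = (if b then add_parallel n j (graph N) else subdivide n j (graph N)),
         selections = (selections N)(j := selections N j + 1, n := 0) \<rparr>))"

text \<open>There is no network of size 0; the value for 0 is a dummy.\<close>

fun saturation_network :: "real \<Rightarrow> nat \<Rightarrow> network pmf" where
  "saturation_network p 0 = return_pmf single_edge"
| "saturation_network p (Suc 0) = return_pmf single_edge"
| "saturation_network p (Suc (Suc n)) =
     bind_pmf (saturation_network p (Suc n)) (saturation_step p (Suc (Suc n)))"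

definition source_degree :: "network \<Rightarrow> nat" where
  "source_degree N = in_degree (graph N) source + out_degree (graph N) source"

definition source_degree_pmf :: "real \<Rightarrow> nat \<Rightarrow> nat pmf" where
  "source_degree_pmf p n = map_pmf source_degree (saturation_network p n)"

definition mittag_leffler :: "real \<Rightarrow> real measure \<Rightarrow> bool" where
  "mittag_leffler \<alpha> M \<longleftrightarrow> real_distribution M \<and>
     (\<forall>r::nat. has_bochner_integral M (\<lambda>x. x ^ r) (fact r / Gamma (real r * \<alpha> + 1)))"

text \<open>
  Every network of size n that can occur has edges labelled 1 to n, its nodes are smaller than
  the next new one, and its total selection weight is n + 1. Hence \<open>pmf_proportional_pmf\<close>
  applies in every step of the process.
\<close>

lemma saturation_network_invariant:
  assumes "N \<in> set_pmf (saturation_network p n)" "n \<ge> 1"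
  shows "fin_digraph (graph N)" "arcs (graph N) = {1..n}" "verts (graph N) \<subseteq> {..max 1 n}"
    and "\<And>j. j \<in> {1..n} \<Longrightarrow> selections N j \<le> 2"
    and "(\<Sum>j\<in>{1..n}. 2 - real (selections N j)) = real n + 1"
proof -
  have "fin_digraph (graph N) \<and> arcs (graph N) = {1..n} \<and> verts (graph N) \<subseteq> {..max 1 n}
    \<and> (\<forall>j\<in>{1..n}. selections N j \<le> 2) \<and> (\<Sum>j\<in>{1..n}. 2 - real (selections N j)) = real n + 1"
    using assms
  proof (induction p n arbitrary: N rule: saturation_network.induct)
    case (1 p)
    then show ?case by simp
  next
    case (2 p)
    then show ?case
      by (auto simp: single_edge_def source_def sink_def fin_digraph_def fin_digraph_axioms_def
            wf_digraph_def)
  next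
    case (3 p n)
    from "3.prems" obtain N' where N': "N' \<in> set_pmf (saturation_network p (Suc n))"
      and N: "N \<in> set_pmf (saturation_step p (Suc (Suc n)) N')"
      by auto
    define w where "w = (\<lambda>j. 2 - real (selections N' j))"
    have inv: "fin_digraph (graph N')" "arcs (graph N') = {1..Suc n}"
      "verts (graph N') \<subseteq> {..max 1 (Suc n)}" "\<And>j. j \<in> {1..Suc n} \<Longrightarrow> selections N' j \<le> 2"
      "(\<Sum>j\<in>{1..Suc n}. w j) = real (Suc n) + 1"
      using "3.IH"[OF N'] unfolding w_def by auto
    have pmf: "pmf (proportional_pmf {1..Suc n} w) j = (if j \<in> {1..Suc n} then w j / sum w {1..Suc n} else 0)"
      for j
    proof (rule pmf_proportional_pmf)
      show "0 \<le> w x" if "x \<in> {1..Suc n}" for x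
        using inv(4)[OF that] by (simp add: w_def)
      show "0 < sum w {1..Suc n}" using inv(5) by linarith
    qed simp
    from N obtain j b where j: "j \<in> set_pmf (proportional_pmf {1..Suc n} w)"
      and N_eq: "N = \<lparr> graph = (if b then add_parallel (Suc (Suc n)) j (graph N')
          else subdivide (Suc (Suc n)) j (graph N')),
         selections = (selections N')(j := selections N' j + 1, Suc (Suc n) := 0) \<rparr>"
      by (auto simp: saturation_step_def inv(2) w_def[symmetric])
    have j_in: "j \<in> {1..Suc n}" and "w j \<noteq> 0"
      using j pmf[of j] by (auto simp: set_pmf_eq split: if_splits)
    with inv(4)[OF j_in] have sel_j: "selections N' j < 2"
      by (cases "selections N' j = 2") (auto simp: w_def)
    have "fin_digraph (graph N)"
      using inv(1) j_in inv(2)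
      by (auto simp: N_eq add_parallel_def subdivide_def fin_digraph_def fin_digraph_axioms_def
            wf_digraph_def)
    moreover have "arcs (graph N) = {1..Suc (Suc n)}"
      using inv(2) by (auto simp: N_eq add_parallel_def subdivide_def)
    moreover have "verts (graph N) \<subseteq> {..max 1 (Suc (Suc n))}"
    proof -
      have "verts (graph N) \<subseteq> insert (Suc (Suc n)) (verts (graph N'))"
        by (auto simp: N_eq add_parallel_def subdivide_def)
      also have "\<dots> \<subseteq> {..max 1 (Suc (Suc n))}"
        using inv(3) by auto
      finally show ?thesis .
    qed
    moreover have "\<forall>i\<in>{1..Suc (Suc n)}. selections N i \<le> 2"
      using inv(4) sel_j by (auto simp: N_eq)
    moreover have "(\<Sum>i\<in>{1..Suc (Suc n)}. 2 - real (selections N i)) = real (Suc (Suc n)) + 1"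
    proof -
      have "(\<Sum>i\<in>{1..Suc (Suc n)}. 2 - real (selections N i))
          = (\<Sum>i\<in>{1..Suc n}. 2 - real (selections N i)) + 2"
        by (simp add: N_eq)
      also have "(\<Sum>i\<in>{1..Suc n}. 2 - real (selections N i))
          = (\<Sum>i\<in>{1..Suc n}. w i - (if i = j then 1 else 0))"
        using j_in by (intro sum.cong) (auto simp: N_eq w_def)
      also have "\<dots> = real (Suc n)"
        using j_in inv(5) by (simp add: sum_subtractf)
      finally show ?thesis by simp
    qed
    ultimately show ?case by blast
  qed
  then show "fin_digraph (graph N)" "arcs (graph N) = {1..n}"
    "verts (graph N) \<subseteq> {..max 1 n}" "\<And>j. j \<in> {1..n} \<Longrightarrow> selections N j \<le> 2"
    "(\<Sum>j\<in>{1..n}. 2 - real (selections N j)) = real n + 1"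
    by auto
qed

end

theory Submission
  imports Defs
begin

text \<open>
  Let \<open>W\<close> be the total selection weight of the edges at the source, and \<open>D\<close> their number. Given
  the network of size \<open>n\<close>, an edge at the source is selected with probability \<open>W / (n + 1)\<close>, and then
  \<open>(W, D)\<close> becomes \<open>(W + 1, D + 1)\<close> with probability \<open>p\<close> and \<open>(W - 1, D)\<close> otherwise, so \<open>(W, D)\<close> is a
  lazy birth-death chain started at \<open>(2, 1)\<close>.

  Since \<open>\<Sum> 1 / n\<close> diverges, the chain leaves every state with \<open>W > 0\<close>; the limits of the point
  probabilities are thus those of the simple walk absorbed at 0, given by ballot numbers. For
  \<open>p \<le> 1 / 2\<close> they add up to 1: \<open>s\<^sup>D x\<^sup>W\<close> has constant expectation \<open>s x\<^sup>2\<close> for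
  \<open>s = (x - (1 - p)) / (p x\<^sup>2)\<close>, and \<open>x \<longlongrightarrow> 1\<close> excludes a loss of mass.

  For \<open>p > 1 / 2\<close> the generator of \<open>W\<close> has explicit polynomial eigenfunctions of every degree \<open>r\<close>, with
  eigenvalue \<open>r (2 p - 1)\<close>, which give the asymptotics of all moments of \<open>W / n powr (2 p - 1)\<close>. The
  method of moments yields the limit law of \<open>W\<close>, and a martingale carries it over to \<open>D\<close>.
\<close>

section \<open>Asymptotics and characteristic functions\<close>

text \<open>The product is \<open>pochhammer (c + x) n / pochhammer c n\<close>, and Euler's limit
  formula for Gamma describes both factors; their powers of n differ by exactly
  \<open>n powr x\<close>.\<close>

lemma prod_one_plus_asymp:
  fixes c :: nat and x :: real
  assumes "c \<ge> 1" "x > 0"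
  shows "(\<lambda>n. (\<Prod>k<n. 1 + x / real (c + k)) / real n powr x) \<longlonglongrightarrow> Gamma (real c) / Gamma (real c + x)"
proof -
  have prod_eq: "(\<Prod>k<n. 1 + x / real (c + k)) = pochhammer (real c + x) n / pochhammer (real c) n" for n
    unfolding pochhammer_prod lessThan_atLeast0 prod_dividef[symmetric]
    using assms by (intro prod.cong) (auto simp: field_simps)
  have "(\<lambda>n. Gamma_series' (real c) n / Gamma_series' (real c + x) n)
      \<longlonglongrightarrow> Gamma (real c) / Gamma (real c + x)"
    using assms by (intro tendsto_divide Gamma_series'_LIMSEQ) (auto intro!: Gamma_real_pos order.strict_implies_not_eq[symmetric] add_pos_pos)
  moreover have "\<forall>\<^sub>F n in sequentially. Gamma_series' (real c) n / Gamma_series' (real c + x) n =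
     (\<Prod>k<n. 1 + x / real (c + k)) / real n powr x"
    using eventually_gt_at_top[of 0]
  proof eventually_elim
    case (elim n)
    have "exp ((real c + x) * ln (real n)) = exp (real c * ln (real n)) * (real n powr x)"
      using elim by (simp add: powr_def exp_add[symmetric] algebra_simps)
    moreover have "pochhammer (real c) n \<noteq> 0" "pochhammer (real c + x) n \<noteq> 0"
      using assms by (auto intro!: order.strict_implies_not_eq[symmetric] pochhammer_pos)
    ultimately show ?case
      using elim unfolding prod_eq Gamma_series'_def by (simp add: field_simps)
  qed
  ultimately show ?thesis
    by (rule Lim_transform_eventually)
qed

text \<open>With Y = X powr (1/\<alpha>) one has X^r = Y powr (r \<alpha>), so rounding r \<alpha>
  down to k bounds the quotient by Y times a term Y^k / k! of the exponential series. This is the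
  growth condition of \<open>char_tendsto_of_moments\<close> for Mittag-Leffler moments.\<close>

lemma power_over_Gamma_tendsto_0:
  fixes \<alpha> x :: real
  assumes "\<alpha> > 0"
  shows "(\<lambda>r::nat. x ^ r / Gamma (real r * \<alpha> + 1)) \<longlonglongrightarrow> 0"
proof -
  define X where "X = max 1 \<bar>x\<bar>"
  define Y where "Y = X powr (1 / \<alpha>)"
  define k where "k r = nat \<lfloor>real r * \<alpha>\<rfloor>" for r :: nat
  have X1: "X \<ge> 1" and Y1: "Y \<ge> 1"
    using assms by (auto simp: X_def Y_def intro!: ge_one_powr_ge_zero)
  have klim: "filterlim k at_top sequentially"
    unfolding k_def using assms
    by (intro filterlim_compose[OF filterlim_nat_sequentially] filterlim_compose[OF filterlim_floor_sequentially]
        filterlim_at_top_mult_tendsto_pos[OF tendsto_const _ filterlim_real_sequentially])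
  have "(\<lambda>j. Y * (Y ^ j / fact j)) \<longlonglongrightarrow> Y * 0"
    using summable_LIMSEQ_zero[OF summable_exp[of Y]] by (intro tendsto_mult tendsto_const) (simp add: field_simps)
  from filterlim_compose[OF this klim]
  have lim: "(\<lambda>r. Y * (Y ^ k r / fact (k r))) \<longlonglongrightarrow> 0" by simp
  show ?thesis
  proof (rule Lim_null_comparison[OF _ lim])
    have "\<forall>\<^sub>F r in sequentially. k r \<ge> 1"
      using klim by (simp add: filterlim_at_top)
    then show "\<forall>\<^sub>F r in sequentially. norm (x ^ r / Gamma (real r * \<alpha> + 1)) \<le> Y * (Y ^ k r / fact (k r))"
    proof eventually_elim
      case (elim r)
      have kle: "real (k r) \<le> real r * \<alpha>" "real r * \<alpha> \<le> real (k r) + 1"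
        using assms by (auto simp: k_def of_nat_nat)
      \<comment> \<open>Gamma increases only beyond its minimum between 1 and 2;
        \<open>k r \<ge> 1\<close> puts both arguments at 2 or more.\<close>
      have "Gamma (real (k r) + 1) \<le> Gamma (real r * \<alpha> + 1)"
        using elim kle Gamma_real_strict_mono[of "real (k r) + 1" "real r * \<alpha> + 1"]
        by (cases "real (k r) = real r * \<alpha>") auto
      then have G: "fact (k r) \<le> Gamma (real r * \<alpha> + 1)"
        using Gamma_fact[of "k r", where 'a = real] by (simp add: add.commute)
      have "\<bar>x\<bar> ^ r \<le> X ^ r"
        by (intro power_mono) (auto simp: X_def)
      also have "X ^ r = Y powr (real r * \<alpha>)"
        using X1 assms by (simp add: Y_def powr_powr powr_realpow)
      also have "\<dots> \<le> Y powr (real (k r) + 1)"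
        using Y1 kle by (intro powr_mono) auto
      also have "\<dots> = Y * Y ^ k r"
        using Y1 by (simp add: powr_add powr_realpow)
      finally have "\<bar>x\<bar> ^ r \<le> Y * Y ^ k r" .
      moreover have "norm (x ^ r / Gamma (real r * \<alpha> + 1)) = \<bar>x\<bar> ^ r / Gamma (real r * \<alpha> + 1)"
        using G by (simp add: power_abs) (metis abs_of_pos fact_gt_zero less_le_trans)
      ultimately show ?case
        using G Y1 by (auto intro!: frac_le simp: )
    qed
  qed
qed

text \<open>Taylor expansion of order R leaves an error of at most 2 |t|^R / R! times the R-th
  absolute moment. By \<open>growth\<close> this is small for M at a suitable R, and by convergence
  of the moments it is then small for almost all \<open>\<mu> n\<close> at the same R.\<close>

lemma char_tendsto_of_moments:
  fixes \<mu> :: "nat \<Rightarrow> real measure" and M :: "real measure"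
  assumes dist: "\<And>n. real_distribution (\<mu> n)" "real_distribution M"
    and int: "\<And>n r. integrable (\<mu> n) (\<lambda>x. x ^ r)" "\<And>r. integrable M (\<lambda>x. x ^ r)"
    and mom: "\<And>r. (\<lambda>n. \<integral>x. x ^ r \<partial>\<mu> n) \<longlonglongrightarrow> (\<integral>x. x ^ r \<partial>M)"
    and growth: "\<And>t. (\<lambda>r. t ^ r * (\<integral>x. x ^ r \<partial>M) / fact r) \<longlonglongrightarrow> 0"
  shows "(\<lambda>n. char (\<mu> n) t) \<longlonglongrightarrow> char M t"
proof (rule LIMSEQ_I)
  fix e :: real assume e: "e > 0"
  have "(\<lambda>r. \<bar>t\<bar> ^ r * (\<integral>x. x ^ r \<partial>M) / fact r) \<longlonglongrightarrow> 0" by (rule growth)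
  from LIMSEQ_D[OF this, of "e / 8"] e obtain R0
    where R0: "\<And>r. r \<ge> R0 \<Longrightarrow> norm (\<bar>t\<bar> ^ r * (\<integral>x. x ^ r \<partial>M) / fact r) < e / 8" by auto
  \<comment> \<open>An even order makes the absolute moment in the remainder an ordinary
    one.\<close>
  define R where "R = 2 * R0"
  have evR: "even R" by (simp add: R_def)
  have R: "\<bar>\<bar>t\<bar> ^ R * (\<integral>x. x ^ R \<partial>M) / fact R\<bar> < e / 8"
    using R0[of R] by (simp add: R_def)
  define T where "T N = (\<Sum>k\<le>R. (\<i> * t) ^ k / fact k * complex_of_real (\<integral>x. x ^ k \<partial>N))" for N :: "real measure"
  define Z where "Z N = 2 * \<bar>t\<bar> ^ R / fact R * (\<integral>x. x ^ R \<partial>N)" for N :: "real measure"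
  have approx: "cmod (char N t - T N) \<le> Z N" if "real_distribution N" "\<And>r. integrable N (\<lambda>x. x ^ r)" for N
  proof -
    interpret N: real_distribution N by fact
    have "(\<lambda>x::real. \<bar>x\<bar> ^ R) = (\<lambda>x. x ^ R)" using evR by (auto simp: power_even_abs)
    then show ?thesis
      using N.char_approx1[of R t] that(2) by (simp add: T_def Z_def)
  qed
  have "(T \<circ> \<mu>) \<longlonglongrightarrow> T M"
    unfolding T_def comp_def by (intro tendsto_intros mom)
  then obtain n1 where n1: "\<And>n. n \<ge> n1 \<Longrightarrow> norm (T (\<mu> n) - T M) < e / 4"
    using e LIMSEQ_D[of "T \<circ> \<mu>" "T M" "e / 4"] by auto
  have "(Z \<circ> \<mu>) \<longlonglongrightarrow> Z M"
    unfolding Z_def comp_def by (intro tendsto_intros mom)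
  moreover have ZM: "Z M < e / 4"
  proof -
    have "\<bar>t\<bar> ^ R * (\<integral>x. x ^ R \<partial>M) / fact R < e / 8" using R by linarith
    then show ?thesis by (simp add: Z_def field_simps)
  qed
  ultimately have "\<forall>\<^sub>F n in sequentially. (Z \<circ> \<mu>) n < e / 4"
    by (rule order_tendstoD)
  then obtain n2 where n2: "\<And>n. n \<ge> n2 \<Longrightarrow> Z (\<mu> n) < e / 4"
    by (auto simp: eventually_sequentially)
  show "\<exists>no. \<forall>n\<ge>no. norm (char (\<mu> n) t - char M t) < e"
  proof (intro exI[of _ "max n1 n2"] allI impI)
    fix n assume n: "n \<ge> max n1 n2"
    have "char (\<mu> n) t - char M t = (char (\<mu> n) t - T (\<mu> n)) + (T (\<mu> n) - T M) - (char M t - T M)"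
      by simp
    also have "norm \<dots> \<le> norm (char (\<mu> n) t - T (\<mu> n)) + norm (T (\<mu> n) - T M) + norm (char M t - T M)"
      by (intro order_trans[OF norm_triangle_ineq4] add_mono norm_triangle_ineq order_refl)
    also have "\<dots> < e"
      using approx[OF dist(1) int(1), of n] approx[OF dist(2) int(2)] n1[of n] n2[of n] ZM n e
      by (auto)
    finally show "norm (char (\<mu> n) t - char M t) < e" .
  qed
qed

lemma cmod_iexp_diff_le: "cmod (iexp x - iexp y) \<le> \<bar>x - y\<bar>"
proof -
  have "iexp x - iexp y = iexp y * (iexp (x - y) - 1)"
    by (simp add: algebra_simps exp_add[symmetric])
  also have "cmod \<dots> \<le> \<bar>x - y\<bar>"
    using iexp_approx1[of "x - y" 0] by (simp add: norm_mult)
  finally show ?thesis .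
qed

text \<open>Since x \<mapsto> exp (i t x) is |t|-Lipschitz, variables that are close in mean on the
  same space have close characteristic functions. This is how the degree replaces the
  weight.\<close>

lemma char_pmf_diff_tendsto_0:
  fixes P :: "nat \<Rightarrow> 'a pmf" and X Y :: "nat \<Rightarrow> 'a \<Rightarrow> real"
  assumes fin: "\<And>n. finite (set_pmf (P n))"
    and lim: "(\<lambda>n. measure_pmf.expectation (P n) (\<lambda>s. \<bar>X n s - Y n s\<bar>)) \<longlonglongrightarrow> 0"
  shows "(\<lambda>n. char (distr (P n) borel (X n)) t - char (distr (P n) borel (Y n)) t) \<longlonglongrightarrow> 0"
proof (rule Lim_null_comparison)
  show "(\<lambda>n. \<bar>t\<bar> * measure_pmf.expectation (P n) (\<lambda>s. \<bar>X n s - Y n s\<bar>)) \<longlonglongrightarrow> 0"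
    using tendsto_mult[OF tendsto_const lim, of "\<bar>t\<bar>"] by simp
  show "\<forall>\<^sub>F n in sequentially. norm (char (distr (P n) borel (X n)) t - char (distr (P n) borel (Y n)) t)
      \<le> \<bar>t\<bar> * measure_pmf.expectation (P n) (\<lambda>s. \<bar>X n s - Y n s\<bar>)"
  proof (intro always_eventually allI)
    fix n
    note int = integrable_measure_pmf_finite[OF fin[of n]]
    have "char (distr (P n) borel (X n)) t - char (distr (P n) borel (Y n)) t
      = measure_pmf.expectation (P n) (\<lambda>s. iexp (t * X n s) - iexp (t * Y n s))"
      unfolding char_def by (simp add: integral_distr int)
    also have "norm \<dots> \<le> measure_pmf.expectation (P n) (\<lambda>s. norm (iexp (t * X n s) - iexp (t * Y n s)))"
      by (rule integral_norm_bound)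
    also have "\<dots> \<le> measure_pmf.expectation (P n) (\<lambda>s. \<bar>t\<bar> * \<bar>X n s - Y n s\<bar>)"
      using cmod_iexp_diff_le[of "t * X n _" "t * Y n _"]
      by (intro integral_mono int) (simp add: right_diff_distrib[symmetric] abs_mult)
    finally show "norm (char (distr (P n) borel (X n)) t - char (distr (P n) borel (Y n)) t)
      \<le> \<bar>t\<bar> * measure_pmf.expectation (P n) (\<lambda>s. \<bar>X n s - Y n s\<bar>)" by simp
  qed
qed

section \<open>Lazy birth-death chains\<close>

text \<open>Two independent coins, one for moving at all and one for the direction, mirror the
  selection of an edge at the source and the choice between parallel and series. At w = 0 the chain
  never moves, so the truncated \<open>w - 1\<close> does no harm.\<close>

definition bd_step :: "real \<Rightarrow> real \<Rightarrow> nat \<Rightarrow> nat \<times> nat \<Rightarrow> (nat \<times> nat) pmf" where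
  "bd_step a b m = (\<lambda>(w, d).
     bind_pmf (bernoulli_pmf ((a + b) * real w / real m)) (\<lambda>s.
     bind_pmf (bernoulli_pmf (a / (a + b))) (\<lambda>u.
     return_pmf (if s then if u then (w + 1, d + 1) else (w - 1, d) else (w, d)))))"

fun bd_chain :: "real \<Rightarrow> real \<Rightarrow> nat \<Rightarrow> nat \<times> nat \<Rightarrow> nat \<Rightarrow> (nat \<times> nat) pmf" where
  "bd_chain a b m s 0 = return_pmf s"
| "bd_chain a b m s (Suc k) = bind_pmf (bd_chain a b m s k) (bd_step a b (m + k))"

lemma expectation_bernoulli_bind:
  fixes h :: "'a \<Rightarrow> real"
  assumes "0 \<le> q" "q \<le> 1" "\<And>x. finite (set_pmf (F x))"
  shows "measure_pmf.expectation (bind_pmf (bernoulli_pmf q) F) h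
    = q * measure_pmf.expectation (F True) h + (1 - q) * measure_pmf.expectation (F False) h"
  using assms by (subst pmf_expectation_bind[of UNIV]) (auto simp: UNIV_bool)

text \<open>Two instances are intended: the state of the source, with rates p and 1 - p, and the
  pure birth chain that yields the Mittag-Leffler law. The bound \<open>w0 \<le> m\<close> persists
  as \<open>w \<le> m + k\<close>, which together with \<open>a + b \<le> 1\<close> keeps the
  probability of a move at most 1.\<close>

locale birth_death =
  fixes a b :: real and m w0 d0 :: nat
  assumes a_pos: "0 < a" and b_nonneg: "0 \<le> b" and rate_le_1: "a + b \<le> 1"
    and w0_le: "w0 \<le> m" and m_pos: "0 < m"
begin

abbreviation "chain \<equiv> bd_chain a b m (w0, d0)"

definition E :: "nat \<Rightarrow> (nat \<Rightarrow> nat \<Rightarrow> real) \<Rightarrow> real" where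
  "E k f = measure_pmf.expectation (chain k) (\<lambda>(w, d). f w d)"

lemma set_pmf_chain: "set_pmf (chain k) \<subseteq> {..m + k} \<times> {..d0 + k}"
proof (induction k)
  case (Suc k)
  show ?case
  proof
    fix y assume "y \<in> set_pmf (chain (Suc k))"
    then obtain x where "x \<in> set_pmf (chain k)" "y \<in> set_pmf (bd_step a b (m + k) x)"
      by auto
    with Suc show "y \<in> {..m + Suc k} \<times> {..d0 + Suc k}"
      by (cases x) (auto simp: bd_step_def split: if_splits)
  qed
qed (use w0_le in auto)

lemma finite_set_pmf_chain: "finite (set_pmf (chain k))"
  by (rule finite_subset[OF set_pmf_chain]) auto

lemma E_0: "E 0 f = f w0 d0"
  by (simp add: E_def)

text \<open>Collects the one-step mean as the old value plus w / M times the increments weighted by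
  their rates. In this form the generator no longer depends on time.\<close>

lemma expectation_bd_step:
  fixes f :: "nat \<Rightarrow> nat \<Rightarrow> real"
  assumes "w \<le> M" "0 < M"
  shows "measure_pmf.expectation (bd_step a b M (w, d)) (\<lambda>(w, d). f w d)
    = f w d + real w / real M * (a * (f (w + 1) (d + 1) - f w d) + b * (f (w - 1) d - f w d))"
proof -
  have ab: "a + b > 0" using a_pos b_nonneg by simp
  define q where "q = (a + b) * real w / real M"
  define u where "u = a / (a + b)"
  have "(a + b) * real w \<le> 1 * real M"
    using rate_le_1 assms ab by (intro mult_mono) auto
  then have q: "0 \<le> q" "q \<le> 1"
    using ab assms by (auto simp: q_def)
  have u: "0 \<le> u" "u \<le> 1"
    using a_pos b_nonneg by (auto simp: u_def)
  have fin: "finite (set_pmf (bernoulli_pmf r))" for r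
    by (rule finite_subset[of _ UNIV]) auto
  have inner: "measure_pmf.expectation
      (bind_pmf (bernoulli_pmf u) (\<lambda>u. return_pmf (if u then (w + 1, d + 1) else (w - 1, d)))) (\<lambda>(w, d). f w d)
    = u * f (w + 1) (d + 1) + (1 - u) * f (w - 1) d"
    using u by (subst expectation_bernoulli_bind) auto
  have "measure_pmf.expectation (bd_step a b M (w, d)) (\<lambda>(w, d). f w d)
    = q * (u * f (w + 1) (d + 1) + (1 - u) * f (w - 1) d) + (1 - q) * f w d"
    unfolding bd_step_def prod.case q_def[symmetric] u_def[symmetric] using q
    by (subst expectation_bernoulli_bind) (simp_all only: inner if_True if_False bind_pmf_const, auto simp: fin set_bind_pmf)
  also have "q * (u * f (w + 1) (d + 1) + (1 - u) * f (w - 1) d) + (1 - q) * f w d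
     = f w d + q * (u * (f (w + 1) (d + 1) - f w d) + (1 - u) * (f (w - 1) d - f w d))"
    by (simp add: algebra_simps)
  also have "\<dots> = f w d + real w / real M * (a * (f (w + 1) (d + 1) - f w d) + b * (f (w - 1) d - f w d))"
  proof -
    have "1 - u = b / (a + b)" using ab by (simp add: u_def field_simps)
    with ab show ?thesis by (simp add: q_def u_def add_divide_distrib[symmetric])
  qed
  finally show ?thesis .
qed

lemma E_sum: "E k f = (\<Sum>(w, d)\<in>set_pmf (chain k). pmf (chain k) (w, d) * f w d)"
  unfolding E_def
  by (subst integral_measure_pmf[OF finite_set_pmf_chain]) (auto simp: case_prod_unfold)

lemma E_add: "E k (\<lambda>w d. f w d + g w d) = E k f + E k g"
  and E_diff: "E k (\<lambda>w d. f w d - g w d) = E k f - E k g"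
  and E_cmult: "E k (\<lambda>w d. c * f w d) = c * E k f"
  and E_mono: "(\<And>w d. f w d \<le> g w d) \<Longrightarrow> E k f \<le> E k g"
  by (auto simp: E_sum case_prod_unfold algebra_simps sum.distrib sum_subtractf sum_distrib_left
      intro!: sum_mono mult_right_mono)

lemma E_const: "E k (\<lambda>w d. c) = c"
  by (simp add: E_def case_prod_unfold)

lemma E_cong:
  assumes "\<And>w d. w \<le> m + k \<Longrightarrow> f w d = g w d"
  shows "E k f = E k g"
  unfolding E_sum using set_pmf_chain[of k] assms by (intro sum.cong) (auto simp: subset_iff)

lemma E_Suc: "E (Suc k) f = E k (\<lambda>w d. f w d
   + real w / real (m + k) * (a * (f (w + 1) (d + 1) - f w d) + b * (f (w - 1) d - f w d)))"
proof -
  have "E (Suc k) f = (\<Sum>s\<in>set_pmf (chain k). pmf (chain k) s *\<^sub>R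
      measure_pmf.expectation (bd_step a b (m + k) s) (\<lambda>(w, d). f w d))"
    unfolding E_def bd_chain.simps
  proof (rule pmf_expectation_bind[OF finite_set_pmf_chain _ subset_refl])
    fix s :: "nat \<times> nat"
    show "finite (set_pmf (bd_step a b (m + k) s))"
      by (cases s) (auto simp: bd_step_def intro!: finite_subset[OF subset_UNIV])
  qed
  also have "\<dots> = E k (\<lambda>w d. f w d
   + real w / real (m + k) * (a * (f (w + 1) (d + 1) - f w d) + b * (f (w - 1) d - f w d)))"
    unfolding E_sum
  proof (intro sum.cong refl)
    fix s assume s: "s \<in> set_pmf (chain k)"
    obtain w d where wd: "s = (w, d)" by force
    then have "w \<le> m + k" using s set_pmf_chain[of k] by auto
    then show "pmf (chain k) s *\<^sub>R measure_pmf.expectation (bd_step a b (m + k) s) (\<lambda>(w, d). f w d) =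
       (case s of (w, d) \<Rightarrow> pmf (chain k) (w, d) * (f w d
   + real w / real (m + k) * (a * (f (w + 1) (d + 1) - f w d) + b * (f (w - 1) d - f w d))))"
      using m_pos by (simp add: wd expectation_bd_step)
  qed
  finally show ?thesis .
qed

text \<open>Step j multiplies the mean of an eigenfunction with eigenvalue x by 1 + x / (m + j); for
  x = 0 the mean is conserved.\<close>

lemma E_eigen:
  assumes "\<And>w d. real w * (a * (f (w + 1) (d + 1) - f w d) + b * (f (w - 1) d - f w d)) = x * f w d"
  shows "E k f = f w0 d0 * (\<Prod>j<k. 1 + x / real (m + j))"
proof (induction k)
  case (Suc k)
  have "E (Suc k) f = E k (\<lambda>w d. (1 + x / real (m + k)) * f w d)"
    unfolding E_Suc
  proof (intro E_cong)
    fix w d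
    show "f w d + real w / real (m + k) * (a * (f (w + 1) (d + 1) - f w d) + b * (f (w - 1) d - f w d))
      = (1 + x / real (m + k)) * f w d"
      using assms[of w d] m_pos by (simp add: field_simps)
  qed
  then show ?case
    using Suc by (simp only: E_cmult prod.lessThan_Suc) simp
qed (simp add: E_0)

lemma E_invariant:
  assumes "\<And>w d. real w * (a * (f (w + 1) (d + 1) - f w d) + b * (f (w - 1) d - f w d)) = 0"
  shows "E k f = f w0 d0"
  using E_eigen[of f 0 k] assms by simp

section \<open>Eigenfunctions of the generator\<close>

text \<open>The coefficients of \<open>((1 - b y) / (1 - a y)) ^ w\<close> in \<open>y\<close> are the eigenfunctions of the
  generator of the chain, with eigenvalues \<open>r (a - b)\<close>.\<close>

definition eigen_gf :: "real fps" where
  "eigen_gf = (1 - fps_const b * fps_X) * inverse (1 - fps_const a * fps_X)"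

definition eigenfun :: "nat \<Rightarrow> nat \<Rightarrow> real" where
  "eigenfun r w = fps_nth (eigen_gf ^ w) r"

lemma eigen_gf_mult: "(1 - fps_const a * fps_X) * eigen_gf = 1 - fps_const b * fps_X"
  using inverse_mult_eq_1'[of "1 - fps_const a * fps_X"] by (simp add: eigen_gf_def mult.left_commute)

lemma deriv_eigen_gf:
  "(1 - fps_const a * fps_X) * (1 - fps_const a * fps_X) * fps_deriv eigen_gf = fps_const (a - b)"
proof -
  let ?A = "1 - fps_const a * fps_X" and ?B = "1 - fps_const b * fps_X :: real fps"
  have "fps_deriv (?A * eigen_gf) = fps_deriv ?B"
    by (simp add: eigen_gf_mult)
  then have "?A * fps_deriv eigen_gf = fps_const a * eigen_gf - fps_const b"
    by (simp add: fps_deriv_mult algebra_simps flip: fps_const_neg)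
  then have "?A * ?A * fps_deriv eigen_gf = fps_const a * (?A * eigen_gf) - fps_const b * ?A"
    by algebra
  also have "\<dots> = fps_const (a - b)"
    unfolding eigen_gf_mult by (simp add: algebra_simps flip: fps_const_sub)
  finally show ?thesis .
qed

text \<open>Up to the factor w Q^(w-1), the left side is the generator applied to Q^w for Q =
  \<open>eigen_gf\<close>; the right side exchanges it for the operator y d/dy, whose eigenvectors
  are the powers of y. The identity is checked after multiplication by (1 - a y)^2, which is then
  cancelled.\<close>

lemma eigen_gf_quadratic:
  "fps_const a * eigen_gf\<^sup>2 - fps_const (a + b) * eigen_gf + fps_const b
     = fps_const (a - b) * fps_X * fps_deriv eigen_gf"
proof -
  let ?A = "1 - fps_const a * fps_X" and ?B = "1 - fps_const b * fps_X :: real fps"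
  have "?A * ?A * (fps_const a * eigen_gf\<^sup>2 - fps_const (a + b) * eigen_gf + fps_const b)
    = fps_const a * (?A * eigen_gf)\<^sup>2 - fps_const (a + b) * ?A * (?A * eigen_gf) + fps_const b * ?A\<^sup>2"
    by algebra
  also have "\<dots> = fps_const (a - b) * fps_X * fps_const (a - b)"
    unfolding eigen_gf_mult fps_const_sub[symmetric] fps_const_add[symmetric] by algebra
  also have "\<dots> = ?A * ?A * (fps_const (a - b) * fps_X * fps_deriv eigen_gf)"
    unfolding deriv_eigen_gf[symmetric] by algebra
  finally have "?A * ?A * (fps_const a * eigen_gf\<^sup>2 - fps_const (a + b) * eigen_gf + fps_const b) = \<dots>" .
  moreover have "fps_nth ?A 0 \<noteq> 0" by simp
  then have "?A \<noteq> 0" by (metis fps_zero_nth)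
  ultimately show ?thesis by simp
qed

text \<open>This gives the logarithmic derivative (a - b) / ((1 - a y) (1 - b y)), whose quadratic
  denominator is the origin of the three-term recurrence below.\<close>

lemma eigen_gf_mult_deriv:
  "(1 - fps_const a * fps_X) * (1 - fps_const b * fps_X) * fps_deriv eigen_gf
     = fps_const (a - b) * eigen_gf"
proof -
  let ?A = "1 - fps_const a * fps_X" and ?B = "1 - fps_const b * fps_X :: real fps"
  have "?A * (?A * ?B * fps_deriv eigen_gf) = ?B * fps_const (a - b)"
    unfolding deriv_eigen_gf[symmetric] by algebra
  also have "\<dots> = ?A * (fps_const (a - b) * eigen_gf)"
    unfolding eigen_gf_mult[symmetric] by algebra
  finally have "?A * (?A * ?B * fps_deriv eigen_gf) = \<dots>" .
  moreover have "fps_nth ?A 0 \<noteq> 0" by simp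
  then have "?A \<noteq> 0" by (metis fps_zero_nth)
  ultimately show ?thesis by simp
qed

text \<open>On Q^w the generator acts as (a - b) y d/dy, and y d/dy multiplies the coefficient of
  y^r by r. At w = 0 the factor w annihilates both sides before the truncated \<open>w - 1\<close>
  matters.\<close>

lemma eigenfun_generator:
  "real w * (a * (eigenfun r (w + 1) - eigenfun r w) + b * (eigenfun r (w - 1) - eigenfun r w))
     = real r * (a - b) * eigenfun r w"
proof -
  let ?Q = eigen_gf
  have "of_nat w * (fps_const a * (?Q ^ (w + 1) - ?Q ^ w) + fps_const b * (?Q ^ (w - 1) - ?Q ^ w))
    = fps_const (a - b) * (fps_X * fps_deriv (?Q ^ w))"
  proof (cases w)
    case (Suc v)
    have "fps_const a * (?Q ^ (w + 1) - ?Q ^ w) + fps_const b * (?Q ^ (w - 1) - ?Q ^ w)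
      = (fps_const a * ?Q\<^sup>2 - fps_const (a + b) * ?Q + fps_const b) * ?Q ^ v"
      unfolding Suc by (simp add: algebra_simps power2_eq_square flip: fps_const_add)
    then have "of_nat w * (fps_const a * (?Q ^ (w + 1) - ?Q ^ w) + fps_const b * (?Q ^ (w - 1) - ?Q ^ w))
      = of_nat w * (fps_const (a - b) * fps_X * fps_deriv ?Q * ?Q ^ v)"
      by (simp only: eigen_gf_quadratic)
    also have "\<dots> = fps_const (a - b) * (fps_X * fps_deriv (?Q ^ w))"
      unfolding Suc by (simp only: fps_deriv_power diff_Suc_1 fps_of_nat) algebra
    finally show ?thesis .
  qed simp
  then have "fps_nth (of_nat w * (fps_const a * (?Q ^ (w + 1) - ?Q ^ w) + fps_const b * (?Q ^ (w - 1) - ?Q ^ w))) r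
    = fps_nth (fps_const (a - b) * (fps_X * fps_deriv (?Q ^ w))) r" by simp
  moreover have "fps_nth (fps_X * fps_deriv F) r = real r * fps_nth F r" for F :: "real fps"
    by (cases r) auto
  ultimately show ?thesis
    by (simp add: eigenfun_def fps_of_nat[symmetric] mult_ac)
qed

text \<open>Comparing coefficients in (1 - a y) (1 - b y) F' = w (a - b) F for F = Q^w.
  Multiplication by w thus becomes a combination of neighbouring eigenfunctions, which reduces
  ordinary moments to those of the eigenfunctions.\<close>

lemma eigenfun_recurrence:
  "(a - b) * real w * eigenfun r w = real (Suc r) * eigenfun (Suc r) w - (a + b) * real r * eigenfun r w
     + (if r = 0 then 0 else a * b * real (r - 1) * eigenfun (r - 1) w)"
proof -
  let ?A = "1 - fps_const a * fps_X" and ?B = "1 - fps_const b * fps_X :: real fps"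
  define F where "F = eigen_gf ^ w"
  have "?A * ?B * fps_deriv F = of_nat w * fps_const (a - b) * F"
  proof (cases w)
    case (Suc v)
    have "?A * ?B * fps_deriv F = of_nat w * eigen_gf ^ v * (?A * ?B * fps_deriv eigen_gf)"
      unfolding F_def Suc by (simp only: fps_deriv_power diff_Suc_1 fps_of_nat) algebra
    then show ?thesis unfolding eigen_gf_mult_deriv by (simp add: F_def Suc mult_ac)
  qed (simp add: F_def)
  then have "fps_deriv F - fps_const (a + b) * (fps_X * fps_deriv F)
      + fps_const (a * b) * (fps_X * (fps_X * fps_deriv F)) = fps_const (real w) * (fps_const (a - b) * F)"
    unfolding fps_const_add[symmetric] fps_const_mult[symmetric] fps_of_nat by algebra
  then have "fps_nth (fps_deriv F - fps_const (a + b) * (fps_X * fps_deriv F)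
      + fps_const (a * b) * (fps_X * (fps_X * fps_deriv F))) r = fps_nth (fps_const (real w) * (fps_const (a - b) * F)) r"
    by simp
  then show ?thesis
    by (cases r; cases "r - 1") (auto simp: eigenfun_def F_def[symmetric] algebra_simps)
qed

lemma eigenfun_0_left: "eigenfun 0 w = 1"
  by (simp add: eigenfun_def eigen_gf_def fps_nth_power_0)

lemma eigenfun_0_right: "r > 0 \<Longrightarrow> eigenfun r 0 = 0"
  by (simp add: eigenfun_def)

lemma eigenfun_Suc_1: "eigenfun (Suc r) 1 = (a - b) * a ^ r"
proof (induction r)
  case 0
  show ?case using arg_cong[OF eigen_gf_mult, of "\<lambda>F. fps_nth F 1"] eigenfun_0_left[of 1]
    by (simp add: algebra_simps eigenfun_def)
next
  case (Suc r)
  have "eigenfun (Suc (Suc r)) 1 = a * eigenfun (Suc r) 1"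
    using arg_cong[OF eigen_gf_mult, of "\<lambda>F. fps_nth F (Suc (Suc r))"]
    by (simp add: algebra_simps eigenfun_def)
  with Suc show ?case by simp
qed

text \<open>The generator equation at w = 1 determines the value at 2 from those at 1 and 0. The
  argument 2 is the initial weight of the source, and for a + b = 1 the last factor will cancel
  against a Gamma value.\<close>

lemma eigenfun_Suc_2: "eigenfun (Suc r) 2 = (a - b) * a ^ r * (real (Suc r) * (a - b) + a + b) / a"
  using eigenfun_generator[of 1 "Suc r"] a_pos
  by (simp add: eigenfun_Suc_1[simplified] eigenfun_0_right field_simps numeral_2_eq_2)

lemma E_eigenfun: "E k (\<lambda>w d. eigenfun r w) = eigenfun r w0 * (\<Prod>j<k. 1 + real r * (a - b) / real (m + j))"
  by (rule E_eigen) (rule eigenfun_generator)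

section \<open>Asymptotics of the moments of the weight\<close>

lemma E_eigenfun_asymp:
  assumes "a > b"
  shows "(\<lambda>k. E k (\<lambda>w d. eigenfun r w) / real k powr (real r * (a - b)))
    \<longlonglongrightarrow> eigenfun r w0 * (Gamma (real m) / Gamma (real m + real r * (a - b)))"
proof (cases "r = 0")
  \<comment> \<open>The product asymptotics require a positive exponent. Here equality with 1 holds
    only eventually, because \<open>0 powr 0 = 0\<close>.\<close>
  case True
  have "\<forall>\<^sub>F k in sequentially. (1::real) = 1 / real k powr 0"
    using eventually_gt_at_top[of 0] by eventually_elim simp
  then have "(\<lambda>k. 1 / real k powr 0) \<longlonglongrightarrow> 1"
    by (rule Lim_transform_eventually[OF tendsto_const])
  then show ?thesis
    using True m_pos Gamma_real_pos[of "real m", THEN less_imp_neq]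
    by (simp add: eigenfun_0_left E_const)
next
  case False
  have "(\<lambda>k. eigenfun r w0 * ((\<Prod>j<k. 1 + real r * (a - b) / real (m + j)) / real k powr (real r * (a - b))))
    \<longlonglongrightarrow> eigenfun r w0 * (Gamma (real m) / Gamma (real m + real r * (a - b)))"
    using False assms m_pos by (intro tendsto_mult tendsto_const prod_one_plus_asymp) auto
  then show ?thesis by (simp add: E_eigenfun)
qed

text \<open>Induction on i for all r at once: the recurrence trades one factor w for the
  eigenfunction of index r + 1, with coefficient (r + 1) / (a - b), while the other two terms have
  lower order. The case r = 0 gives the plain moments.\<close>

lemma E_power_eigenfun_asymp:
  assumes "a > b"
  shows "(\<lambda>k. E k (\<lambda>w d. real w ^ i * eigenfun r w) / real k powr (real (i + r) * (a - b)))
    \<longlonglongrightarrow> fact (r + i) / fact r / (a - b) ^ i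
        * (eigenfun (r + i) w0 * (Gamma (real m) / Gamma (real m + real (r + i) * (a - b))))"
proof (induction i arbitrary: r)
  case 0
  show ?case using E_eigenfun_asymp[OF assms, of r] by simp
next
  case (Suc i)
  define \<alpha> where "\<alpha> = a - b"
  have \<alpha>: "\<alpha> > 0" using assms by (simp add: \<alpha>_def)
  define L where "L i r = fact (r + i) / fact r / \<alpha> ^ i
        * (eigenfun (r + i) w0 * (Gamma (real m) / Gamma (real m + real (r + i) * \<alpha>)))" for i r
  define e where "e k r = E k (\<lambda>w d. real w ^ i * eigenfun r w)" for k r
  have IH: "(\<lambda>k. e k r / real k powr (real (i + r) * \<alpha>)) \<longlonglongrightarrow> L i r" for r
    using Suc.IH unfolding L_def \<alpha>_def e_def .
  \<comment> \<open>For r' \<le> r the true order of growth falls short of the normalisation by at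
    least one power of k powr (a - b).\<close>
  have lower: "(\<lambda>k. e k r' / real k powr (real (i + r + 1) * \<alpha>)) \<longlonglongrightarrow> 0" if "r' \<le> r" for r'
  proof -
    have "(\<lambda>k. e k r' / real k powr (real (i + r') * \<alpha>) * real k powr - (real (r - r' + 1) * \<alpha>)) \<longlonglongrightarrow> L i r' * 0"
      using \<alpha> by (intro tendsto_mult IH tendsto_neg_powr filterlim_real_sequentially) auto
    moreover have "real (i + r') * \<alpha> + real (r - r' + 1) * \<alpha> = real (i + r + 1) * \<alpha>"
      using that by (simp add: of_nat_diff algebra_simps)
    then have "e k r' / real k powr (real (i + r') * \<alpha>) * real k powr - (real (r - r' + 1) * \<alpha>)
       = e k r' / real k powr (real (i + r + 1) * \<alpha>)" for k
      by (simp add: powr_minus divide_inverse powr_add[symmetric] flip: inverse_mult_distrib)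
    ultimately show ?thesis by simp
  qed
  have "E k (\<lambda>w d. real w ^ Suc i * eigenfun r w)
    = E k (\<lambda>w d. 1 / \<alpha> * (real (Suc r) * (real w ^ i * eigenfun (Suc r) w)
        - (a + b) * real r * (real w ^ i * eigenfun r w)
        + (if r = 0 then 0 else a * b * real (r - 1)) * (real w ^ i * eigenfun (r - 1) w)))" for k
  proof (rule E_cong)
    fix w
    have "real w ^ Suc i * eigenfun r w = 1 / \<alpha> * real w ^ i * (\<alpha> * real w * eigenfun r w)"
      using \<alpha> by simp
    also have "\<dots> = 1 / \<alpha> * (real (Suc r) * (real w ^ i * eigenfun (Suc r) w)
        - (a + b) * real r * (real w ^ i * eigenfun r w)
        + (if r = 0 then 0 else a * b * real (r - 1)) * (real w ^ i * eigenfun (r - 1) w))"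
      unfolding \<alpha>_def eigenfun_recurrence by (simp add: algebra_simps)
    finally show "real w ^ Suc i * eigenfun r w = \<dots>" .
  qed
  then have eq: "E k (\<lambda>w d. real w ^ Suc i * eigenfun r w)
    = 1 / \<alpha> * (real (Suc r) * e k (Suc r) - (a + b) * real r * e k r
        + (if r = 0 then 0 else a * b * real (r - 1)) * e k (r - 1))" for k
    by (simp only: E_cmult E_add E_diff e_def)
  have "(\<lambda>k. 1 / \<alpha> * (real (Suc r) * (e k (Suc r) / real k powr (real (i + Suc r) * \<alpha>))
       - (a + b) * real r * (e k r / real k powr (real (i + r + 1) * \<alpha>))
       + (if r = 0 then 0 else a * b * real (r - 1)) * (e k (r - 1) / real k powr (real (i + r + 1) * \<alpha>))))
     \<longlonglongrightarrow> 1 / \<alpha> * (real (Suc r) * L i (Suc r) - (a + b) * real r * 0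
       + (if r = 0 then 0 else a * b * real (r - 1)) * 0)"
    by (intro tendsto_intros IH lower) auto
  also have "1 / \<alpha> * (real (Suc r) * L i (Suc r) - (a + b) * real r * 0
       + (if r = 0 then 0 else a * b * real (r - 1)) * 0) = L (Suc i) r"
    using \<alpha> by (simp add: L_def mult_ac)
  finally have "(\<lambda>k. E k (\<lambda>w d. real w ^ Suc i * eigenfun r w) / real k powr (real (Suc i + r) * \<alpha>)) \<longlonglongrightarrow> L (Suc i) r"
    unfolding eq by (simp add: add_divide_distrib diff_divide_distrib algebra_simps)
  then show ?case
    by (simp add: L_def \<alpha>_def)
qed

lemma E_power_asymp:
  assumes "a > b"
  shows "(\<lambda>k. E k (\<lambda>w d. real w ^ r) / real k powr (real r * (a - b)))
    \<longlonglongrightarrow> fact r / (a - b) ^ r * (eigenfun r w0 * (Gamma (real m) / Gamma (real m + real r * (a - b))))"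
  using E_power_eigenfun_asymp[OF assms, of r 0] by (simp add: eigenfun_0_left)

end

section \<open>The source of a network\<close>

text \<open>Outgoing arcs suffice because no arc ever enters the source, see
  \<open>head_neq_source\<close>.\<close>

definition source_arcs :: "network \<Rightarrow> nat set" where
  "source_arcs N = {j \<in> arcs (graph N). tail (graph N) j = source}"

text \<open>In a network that can occur no arc is selected more than twice, so the truncated
  subtraction agrees with the real weight of the model.\<close>

definition source_weight :: "network \<Rightarrow> nat" where
  "source_weight N = (\<Sum>j\<in>source_arcs N. 2 - selections N j)"

definition updated_network :: "nat \<Rightarrow> network \<Rightarrow> nat \<Rightarrow> bool \<Rightarrow> network" where
  "updated_network n N j b =
     \<lparr> graph = (if b then add_parallel n j (graph N) else subdivide n j (graph N)),
       selections = (selections N)(j := selections N j + 1, n := 0) \<rparr>"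

lemma saturation_step_altdef:
  "saturation_step p n N =
     bind_pmf (proportional_pmf (arcs (graph N)) (\<lambda>j. 2 - real (selections N j))) (\<lambda>j.
     bind_pmf (bernoulli_pmf p) (\<lambda>b. return_pmf (updated_network n N j b)))"
  by (simp add: saturation_step_def updated_network_def)

lemma pmf_selection:
  assumes "N \<in> set_pmf (saturation_network p n)" "n \<ge> 1"
  shows "pmf (proportional_pmf (arcs (graph N)) (\<lambda>j. 2 - real (selections N j))) j
     = (if j \<in> {1..n} then (2 - real (selections N j)) / (real n + 1) else 0)"
  unfolding saturation_network_invariant(2)[OF assms]
  using saturation_network_invariant(4,5)[OF assms]
  by (subst pmf_proportional_pmf) auto

lemma selected_arc:
  assumes "N \<in> set_pmf (saturation_network p n)" "n \<ge> 1"
    and "j \<in> set_pmf (proportional_pmf (arcs (graph N)) (\<lambda>j. 2 - real (selections N j)))"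
  shows "j \<in> {1..n}" "selections N j < 2"
proof -
  have *: "(if j \<in> {1..n} then (2 - real (selections N j)) / (real n + 1) else 0) \<noteq> 0"
    using assms(3) pmf_selection[OF assms(1,2), of j] by (simp add: set_pmf_eq)
  then show "j \<in> {1..n}" by (auto split: if_splits)
  with * saturation_network_invariant(4)[OF assms(1,2), of j] show "selections N j < 2"
    by (cases "selections N j = 2") auto
qed

text \<open>A step only creates heads that are copies of old ones or the new node, and the new node
  is never 0.\<close>

lemma head_neq_source:
  assumes "N \<in> set_pmf (saturation_network p n)" "n \<ge> 1" "e \<in> arcs (graph N)"
  shows "head (graph N) e \<noteq> source"
  using assms
proof (induction p n arbitrary: N e rule: saturation_network.induct)
  case (3 p n)
  then obtain N' j b where N': "N' \<in> set_pmf (saturation_network p (Suc n))"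
    and j: "j \<in> set_pmf (proportional_pmf (arcs (graph N')) (\<lambda>j. 2 - real (selections N' j)))"
    and N: "N = updated_network (Suc (Suc n)) N' j b"
    by (auto simp: saturation_step_altdef)
  have "j \<in> arcs (graph N')"
    using selected_arc(1)[OF N' _ j] saturation_network_invariant(2)[OF N'] by simp
  then show ?case
    using "3.IH"[OF N'] "3.prems"(3)
    by (auto simp: N updated_network_def add_parallel_def subdivide_def source_def split: if_splits)
qed (auto simp: single_edge_def source_def sink_def)

lemma source_degree_eq:
  assumes "N \<in> set_pmf (saturation_network p n)" "n \<ge> 1"
  shows "source_degree N = card (source_arcs N)"
proof -
  have "in_arcs (graph N) source = {}"
    using head_neq_source[OF assms] by (auto simp: in_arcs_def)
  then show ?thesis
    by (simp add: source_degree_def in_degree_def out_degree_def out_arcs_def source_arcs_def)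
qed

text \<open>Selecting an arc at the source costs it one unit of weight. A parallel step also puts a
  fresh arc of weight 2 there, a net gain of 1; in a series step the new arc starts at the new node,
  so only the loss remains.\<close>

lemma updated_network_state:
  fixes b :: bool
  assumes N: "N \<in> set_pmf (saturation_network p n)" "n \<ge> 1"
    and j: "j \<in> set_pmf (proportional_pmf (arcs (graph N)) (\<lambda>j. 2 - real (selections N j)))"
  defines "N' \<equiv> updated_network (Suc n) N j b"
  shows "(source_weight N', card (source_arcs N')) =
    (if j \<in> source_arcs N
     then if b then (source_weight N + 1, card (source_arcs N) + 1)
               else (source_weight N - 1, card (source_arcs N))
     else (source_weight N, card (source_arcs N)))"
proof -
  define S where "S = source_arcs N"
  define f where "f = (\<lambda>i. 2 - selections N i)"
  define f' where "f' = (\<lambda>i. 2 - selections N' i)"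
  have arcs: "arcs (graph N) = {1..n}" and jn: "j \<in> {1..n}" and sel: "selections N j < 2"
    using saturation_network_invariant(2)[OF N] selected_arc[OF N j] by auto
  have fin: "finite S" and new: "Suc n \<notin> S"
    by (auto simp: S_def source_arcs_def arcs)
  have S': "source_arcs N' = (if j \<in> S \<and> b then insert (Suc n) S else S)"
    using jn by (auto simp: N'_def updated_network_def source_arcs_def S_def arcs add_parallel_def
        subdivide_def source_def)
  have f': "f' i = (if i = Suc n then 2 else if i = j then f j - 1 else f i)" for i
    using jn by (auto simp: f'_def f_def N'_def updated_network_def)
  have W: "source_weight N = sum f S" "source_weight N' = sum f' (source_arcs N')"
    by (simp_all add: source_weight_def f_def f'_def S_def)
  have sumf': "sum f' S = (if j \<in> S then sum f S - 1 else sum f S)"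
  proof (cases "j \<in> S")
    case True
    have "sum f' (S - {j}) = sum f (S - {j})"
      using new by (intro sum.cong) (auto simp: f')
    moreover have "f j \<ge> 1" using sel by (simp add: f_def)
    ultimately show ?thesis
      using True new jn by (simp add: sum.remove[OF fin True] f')
  next
    case False
    then show ?thesis using new by (auto simp: f' intro!: sum.cong)
  qed
  have "sum f S \<ge> 1" if "j \<in> S"
    using sel member_le_sum[OF that, of f] fin by (auto simp: f_def)
  moreover have "f' (Suc n) = 2" by (simp add: f')
  ultimately show ?thesis
    using fin new unfolding W S' S_def[symmetric] by (auto simp: sumf')
qed

text \<open>The total weight is n + 1, so the chance of hitting the source is its share of the
  weight. For the state only this event matters, not which arc is hit.\<close>

lemma map_pmf_selection:
  assumes "N \<in> set_pmf (saturation_network p n)" "n \<ge> 1"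
  shows "map_pmf (\<lambda>j. j \<in> source_arcs N)
      (proportional_pmf (arcs (graph N)) (\<lambda>j. 2 - real (selections N j)))
    = bernoulli_pmf (real (source_weight N) / (real n + 1))"
proof -
  let ?P = "proportional_pmf (arcs (graph N)) (\<lambda>j. 2 - real (selections N j))"
  let ?q = "real (source_weight N) / (real n + 1)"
  note inv = saturation_network_invariant[OF assms]
  have S: "source_arcs N \<subseteq> {1..n}"
    unfolding source_arcs_def inv(2) by blast
  then have fin: "finite (source_arcs N)"
    by (rule finite_subset) simp
  have "pmf (map_pmf (\<lambda>j. j \<in> source_arcs N) ?P) True = measure ?P (source_arcs N)"
    unfolding pmf_map by (intro arg_cong[of _ _ "measure (measure_pmf ?P)"]) auto
  also have "\<dots> = (\<Sum>j\<in>source_arcs N. (2 - real (selections N j)) / (real n + 1))"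
    using S fin by (subst measure_measure_pmf_finite) (simp_all only: pmf_selection[OF assms] if_True subsetD cong: sum.cong)
  also have "\<dots> = (\<Sum>j\<in>source_arcs N. real (2 - selections N j) / (real n + 1))"
    using inv(4) S by (intro sum.cong) (auto simp: of_nat_diff)
  also have "\<dots> = ?q"
    unfolding source_weight_def of_nat_sum sum_divide_distrib ..
  finally have T: "pmf (map_pmf (\<lambda>j. j \<in> source_arcs N) ?P) True = ?q" .
  have q: "0 \<le> ?q" "?q \<le> 1"
    by (simp_all only: pmf_nonneg pmf_le_1 flip: T)
  show ?thesis
  proof (rule pmf_eqI)
    fix x
    have "pmf M False = 1 - pmf M True" for M :: "bool pmf"
      using sum_pmf_eq_1[OF finite subset_UNIV, of M] by (simp add: UNIV_bool)
    then show "pmf (map_pmf (\<lambda>j. j \<in> source_arcs N) ?P) x = pmf (bernoulli_pmf ?q) x"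
      using T q by (cases x) simp_all
  qed
qed

text \<open>The conditional law of the next state depends on the network only through the present
  state, so the network process lumps to a Markov chain. Time k of the chain corresponds to size k +
  1.\<close>

lemma saturation_network_eq_chain:
  "map_pmf (\<lambda>N. (source_weight N, source_degree N)) (saturation_network p (Suc k))
     = bd_chain p (1 - p) 2 (2, 1) k"
proof -
  have "map_pmf (\<lambda>N. (source_weight N, card (source_arcs N))) (saturation_network p (Suc k))
     = bd_chain p (1 - p) 2 (2, 1) k"
  proof (induction k)
    case 0
    have "source_arcs single_edge = {1}"
      by (auto simp: source_arcs_def single_edge_def)
    then show ?case
      by (simp add: source_weight_def single_edge_def)
  next
    case (Suc k)
    let ?st = "\<lambda>N. (source_weight N, card (source_arcs N))"
    \<comment> \<open>A network of size k + 1 has total weight k + 2, which is the denominator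
      \<open>2 + k\<close> of the chain.\<close>
    have step: "map_pmf ?st (saturation_step p (Suc (Suc k)) N) = bd_step p (1 - p) (2 + k) (?st N)"
      if N: "N \<in> set_pmf (saturation_network p (Suc k))" for N
    proof -
      let ?P = "proportional_pmf (arcs (graph N)) (\<lambda>j. 2 - real (selections N j))"
      let ?w = "source_weight N" and ?d = "card (source_arcs N)"
      define G where "G s = bind_pmf (bernoulli_pmf p) (\<lambda>b.
        return_pmf (if s then if b then (?w + 1, ?d + 1) else (?w - 1, ?d) else (?w, ?d)))" for s
      have "map_pmf ?st (saturation_step p (Suc (Suc k)) N) = bind_pmf ?P (\<lambda>j. G (j \<in> source_arcs N))"
        unfolding saturation_step_altdef map_bind_pmf map_return_pmf G_def
        by (intro bind_pmf_cong refl arg_cong[of _ _ return_pmf] updated_network_state[OF N]) auto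
      also have "\<dots> = bind_pmf (map_pmf (\<lambda>j. j \<in> source_arcs N) ?P) G"
        by (simp add: bind_map_pmf)
      also have "\<dots> = bd_step p (1 - p) (2 + k) (?st N)"
        using map_pmf_selection[OF N] by (simp add: bd_step_def G_def[abs_def])
      finally show ?thesis .
    qed
    have "map_pmf ?st (saturation_network p (Suc (Suc k)))
      = bind_pmf (saturation_network p (Suc k)) (\<lambda>N. bd_step p (1 - p) (2 + k) (?st N))"
      by (simp add: map_bind_pmf step cong: bind_pmf_cong)
    also have "\<dots> = bind_pmf (map_pmf ?st (saturation_network p (Suc k))) (bd_step p (1 - p) (2 + k))"
      by (simp add: bind_map_pmf)
    finally show ?case
      unfolding Suc by simp
  qed
  moreover have "map_pmf (\<lambda>N. (source_weight N, source_degree N)) (saturation_network p (Suc k))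
    = map_pmf (\<lambda>N. (source_weight N, card (source_arcs N))) (saturation_network p (Suc k))"
    by (intro map_pmf_cong refl) (simp add: source_degree_eq)
  ultimately show ?thesis by simp
qed

lemma source_degree_pmf_eq:
  "source_degree_pmf p (Suc k) = map_pmf snd (bd_chain p (1 - p) 2 (2, 1) k)"
  unfolding source_degree_pmf_def saturation_network_eq_chain[symmetric]
  by (simp add: pmf.map_comp comp_def)

section \<open>Limits of moment sequences and the Mittag-Leffler law\<close>

text \<open>Chebyshev's inequality, with K chosen so large that C / K^2 < e.\<close>

lemma tight_of_second_moments:
  fixes \<mu> :: "nat \<Rightarrow> real measure"
  assumes dist: "\<And>n. real_distribution (\<mu> n)"
    and int: "\<And>n. integrable (\<mu> n) (\<lambda>x. x\<^sup>2)" and le: "\<And>n. (\<integral>x. x\<^sup>2 \<partial>\<mu> n) \<le> C"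
  shows "tight \<mu>"
  unfolding tight_def
proof (intro conjI allI impI dist)
  fix e :: real assume e: "e > 0"
  obtain K where K: "K > 0" "C < e * K\<^sup>2"
  proof
    define K where "K = sqrt ((\<bar>C\<bar> + 1) / e)"
    show "K > 0" "C < e * K\<^sup>2" using e by (auto simp: K_def)
  qed
  have "measure (\<mu> n) {-K<..K} > 1 - e" for n
  proof -
    interpret real_distribution "\<mu> n" by (rule dist)
    have "1 - C / K\<^sup>2 \<le> 1 - (\<integral>x. x\<^sup>2 \<partial>\<mu> n) / K\<^sup>2"
      using le[of n] K by (simp add: divide_right_mono)
    also have "\<dots> = (\<integral>x. 1 - x\<^sup>2 / K\<^sup>2 \<partial>\<mu> n)"
      using int[of n] prob_space by (simp add: space_eq_univ)
    also have "\<dots> \<le> (\<integral>x. indicator {-K<..K} x \<partial>\<mu> n)"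
    proof (intro integral_mono)
      fix x
      show "1 - x\<^sup>2 / K\<^sup>2 \<le> indicator {-K<..K} x"
      proof (cases "x \<in> {-K<..K}")
        case False
        then have "K\<^sup>2 \<le> x\<^sup>2" using K by (auto intro!: power2_le_iff_abs_le[THEN iffD2] simp: abs_le_square_iff[symmetric])
        then show ?thesis using False K by simp
      qed simp
    qed (use int[of n] in \<open>auto simp: less_top[symmetric]\<close>)
    also have "\<dots> = measure (\<mu> n) {-K<..K}" by simp
    finally have "1 - C / K\<^sup>2 \<le> measure (\<mu> n) {-K<..K}" .
    moreover have "C / K\<^sup>2 < e" using K by (simp add: field_simps)
    ultimately show ?thesis by linarith
  qed
  then show "\<exists>a b. a < b \<and> (\<forall>n. measure (\<mu> n) {a<..b} > 1 - e)"
    using K by (intro exI[of _ "-K"] exI[of _ K]) auto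
qed

text \<open>The two powers differ only where |x| > K \<ge> 1, and there |x|^r K \<le> |x|^(r+1)
  \<le> |x|^(2r+2). The even exponent keeps the bound nonnegative and free of absolute
  moments.\<close>

lemma power_clamp_diff_le:
  fixes K x :: real
  assumes "K \<ge> 1"
  shows "\<bar>x ^ r - (max (-K) (min K x)) ^ r\<bar> \<le> 2 / K * x ^ (2 * r + 2)"
proof (cases "\<bar>x\<bar> \<le> K")
  case True
  then have "max (-K) (min K x) = x" by auto
  moreover have "0 \<le> x ^ (2 * r + 2)"
    using zero_le_even_power[of "2 * r + 2" x] by simp
  ultimately show ?thesis using assms by simp
next
  case False
  then have x: "\<bar>x\<bar> > K" by simp
  have "\<bar>max (-K) (min K x)\<bar> \<le> \<bar>x\<bar>" using assms by auto
  then have "\<bar>x ^ r - (max (-K) (min K x)) ^ r\<bar> \<le> \<bar>x\<bar> ^ r + \<bar>x\<bar> ^ r"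
    by (intro order_trans[OF abs_triangle_ineq4] add_mono) (auto simp: power_abs intro!: power_mono)
  also have "\<dots> = 2 / K * (\<bar>x\<bar> ^ r * K)" using assms by simp
  also have "\<bar>x\<bar> ^ r * K \<le> \<bar>x\<bar> ^ r * \<bar>x\<bar>" using x by (intro mult_left_mono) auto
  also have "\<bar>x\<bar> ^ r * \<bar>x\<bar> = \<bar>x\<bar> ^ Suc r" by simp
  also have "\<dots> \<le> \<bar>x\<bar> ^ (2 * r + 2)" using x assms by (intro power_increasing) auto
  also have "\<dots> = x ^ (2 * r + 2)" by (simp add: power_even_abs)
  finally show ?thesis using assms by (simp add: mult_left_mono divide_right_mono)
qed

text \<open>Bounded second moments give tightness, hence a weakly convergent subsequence. Truncation
  at K costs O(1/K) uniformly along it, so the limits of the moments are the moments of the weak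
  limit.\<close>

lemma exists_moment_limit:
  fixes \<mu> :: "nat \<Rightarrow> real measure" and m :: "nat \<Rightarrow> real"
  assumes dist: "\<And>n. real_distribution (\<mu> n)"
    and int: "\<And>n r. integrable (\<mu> n) (\<lambda>x. x ^ r)"
    and mom: "\<And>r. (\<lambda>n. \<integral>x. x ^ r \<partial>\<mu> n) \<longlonglongrightarrow> m r"
  obtains M where "real_distribution M" "\<And>r. has_bochner_integral M (\<lambda>x. x ^ r) (m r)"
proof -
  have "bounded (range (\<lambda>n. \<integral>x. x ^ 2 \<partial>\<mu> n))"
    using mom[of 2] convergent_imp_bounded by blast
  then obtain C where "\<And>n. \<bar>\<integral>x. x ^ 2 \<partial>\<mu> n\<bar> \<le> C"
    by (auto simp: bounded_iff)
  then have "tight \<mu>"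
    using dist int by (intro tight_of_second_moments[of _ C]) (auto simp: abs_le_iff)
  from tight_imp_convergent_subsubsequence[OF this strict_mono_id] obtain s :: "nat \<Rightarrow> nat" and M
    where s: "strict_mono s" and M: "real_distribution M" and wc: "weak_conv_m (\<mu> \<circ> s) M"
    by auto
  interpret M: real_distribution M by fact
  have momS: "(\<lambda>n. \<integral>x. x ^ r \<partial>\<mu> (s n)) \<longlonglongrightarrow> m r" for r
    using LIMSEQ_subseq_LIMSEQ[OF mom s] by (simp add: comp_def)
  have conv: "(\<lambda>n. \<integral>x. f x \<partial>\<mu> (s n)) \<longlonglongrightarrow> (\<integral>x. f x \<partial>M)"
    if "\<And>x. isCont f x" "\<And>x. norm (f x) \<le> B" for f :: "real \<Rightarrow> real" and B
    using weak_conv_imp_integral_bdd_continuous_conv[OF _ M wc that] dist by (simp add: comp_def)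
  \<comment> \<open>The truncations at K are bounded and continuous, so weak convergence bounds
    their integrals by the limit moment; monotone convergence in K removes the truncation.\<close>
  have int_even: "integrable M (\<lambda>x. x ^ (2 * r))" for r
  proof (rule integrableI_bounded)
    have "(\<integral>\<^sup>+x. ennreal (x ^ (2 * r)) \<partial>M) = (\<integral>\<^sup>+x. (SUP K::nat. ennreal (min (x ^ (2 * r)) (real K))) \<partial>M)"
    proof (intro nn_integral_cong antisym)
      fix x :: real
      obtain K :: nat where "x ^ (2 * r) \<le> real K" using real_arch_simple by blast
      then show "ennreal (x ^ (2 * r)) \<le> (SUP K::nat. ennreal (min (x ^ (2 * r)) (real K)))"
        by (intro SUP_upper2[of K]) auto
    qed (auto intro!: SUP_least ennreal_leI)
    also have "\<dots> = (SUP K::nat. (\<integral>\<^sup>+x. ennreal (min (x ^ (2 * r)) (real K)) \<partial>M))"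
      by (intro nn_integral_monotone_convergence_SUP) (auto simp: incseq_def le_fun_def intro!: ennreal_leI)
    also have "\<dots> \<le> ennreal (m (2 * r))"
    proof (rule SUP_least)
      fix K :: nat
      have bdd: "norm (min (x ^ (2 * r)) (real K)) \<le> real K" for x :: real
        by (auto simp: power_mult)
      have "(\<integral>x. min (x ^ (2 * r)) (real K) \<partial>M) \<le> m (2 * r)"
      proof (rule LIMSEQ_le[OF conv[OF _ bdd] momS])
        show "\<exists>N. \<forall>n\<ge>N. (\<integral>x. min (x ^ (2 * r)) (real K) \<partial>\<mu> (s n)) \<le> (\<integral>x. x ^ (2 * r) \<partial>\<mu> (s n))"
        proof (intro exI allI impI integral_mono)
          fix n
          interpret N: real_distribution "\<mu> (s n)" by (rule dist)
          show "integrable (\<mu> (s n)) (\<lambda>x. min (x ^ (2 * r)) (real K))"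
            by (rule N.integrable_const_bound[of _ "real K"]) (use bdd in auto)
        qed (auto simp: int)
      qed (auto intro!: continuous_intros)
      moreover have "integrable M (\<lambda>x. min (x ^ (2 * r)) (real K))"
        by (rule M.integrable_const_bound[of _ "real K"]) (use bdd in auto)
      ultimately show "(\<integral>\<^sup>+x. ennreal (min (x ^ (2 * r)) (real K)) \<partial>M) \<le> ennreal (m (2 * r))"
        by (subst nn_integral_eq_integral) (auto simp: power_mult intro!: ennreal_leI)
    qed
    finally have "(\<integral>\<^sup>+x. ennreal (x ^ (2 * r)) \<partial>M) \<le> ennreal (m (2 * r))" .
    then have "(\<integral>\<^sup>+x. ennreal (x ^ (2 * r)) \<partial>M) < \<infinity>"
      by (simp add: le_less_trans[OF _ ennreal_less_top])
    then show "(\<integral>\<^sup>+x. ennreal (norm (x ^ (2 * r))) \<partial>M) < \<infinity>"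
      by (simp add: power_mult)
  qed auto
  have intM: "integrable M (\<lambda>x. x ^ r)" for r
  proof (rule Bochner_Integration.integrable_bound)
    show "integrable M (\<lambda>x. 1 + x ^ (2 * r))"
      using int_even by auto
    have "\<bar>x ^ r\<bar> \<le> 1 + x ^ (2 * r)" for x :: real
      using sum_power2_ge_zero[of "\<bar>x ^ r\<bar> - 1" 0] zero_le_power2[of "x ^ r"]
      by (simp add: power2_diff power_mult[symmetric] mult.commute)
    then show "AE x in M. norm (x ^ r) \<le> norm (1 + x ^ (2 * r))"
      by (auto intro!: AE_I2 order_trans[OF _ abs_ge_self])
  qed auto
  have "(\<integral>x. x ^ r \<partial>M) = m r" for r
  proof -
    \<comment> \<open>The truncation error arises twice, for M and in the limit along the
      subsequence; A adds up the two moments that control it.\<close>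
    define A where "A = (\<integral>x. x ^ (2 * r + 2) \<partial>M) + m (2 * r + 2)"
    define D where "D = \<bar>(\<integral>x. x ^ r \<partial>M) - m r\<bar>"
    have bound: "D \<le> 2 / K * A" if K: "K \<ge> 1" for K :: real
    proof -
      define g where "g x = (max (-K) (min K x)) ^ r" for x
      have gb: "norm (g x) \<le> K ^ r" for x
        using K by (auto simp: g_def power_abs intro!: power_mono)
      have gc: "isCont g x" for x
        unfolding g_def by (intro continuous_intros)
      have gm: "g \<in> borel_measurable borel" unfolding g_def by measurable
      have approx: "\<bar>(\<integral>x. x ^ r \<partial>N) - (\<integral>x. g x \<partial>N)\<bar> \<le> 2 / K * (\<integral>x. x ^ (2 * r + 2) \<partial>N)"
        if "real_distribution N" and iN: "\<And>r. integrable N (\<lambda>x. x ^ r)" for N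
      proof -
        interpret N: real_distribution N by fact
        have ig: "integrable N g"
          by (rule N.integrable_const_bound[of _ "K ^ r"]) (use gb gm in auto)
        have "\<bar>\<integral>x. x ^ r - g x \<partial>N\<bar> \<le> (\<integral>x. \<bar>x ^ r - g x\<bar> \<partial>N)"
          by (rule integral_abs_bound)
        also have "\<dots> \<le> (\<integral>x. 2 / K * x ^ (2 * r + 2) \<partial>N)"
        proof (intro integral_mono)
          show "integrable N (\<lambda>x. \<bar>x ^ r - g x\<bar>)" "integrable N (\<lambda>x. 2 / K * x ^ (2 * r + 2))"
            using iN ig by (auto simp del: power_Suc)
          show "\<bar>x ^ r - g x\<bar> \<le> 2 / K * x ^ (2 * r + 2)" for x
            unfolding g_def by (rule power_clamp_diff_le[OF K])
        qed
        also have "\<dots> = 2 / K * (\<integral>x. x ^ (2 * r + 2) \<partial>N)"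
          by (rule integral_mult_right_zero)
        finally show ?thesis
          using iN ig by simp
      qed
      have lim: "\<bar>m r - (\<integral>x. g x \<partial>M)\<bar> \<le> 2 / K * m (2 * r + 2)"
        by (rule LIMSEQ_le[OF tendsto_rabs[OF tendsto_diff[OF momS conv[OF gc gb]]]
              tendsto_mult[OF tendsto_const momS]])
           (use approx[OF dist int] in auto)
      show ?thesis
        using lim approx[OF M intM] by (simp add: D_def A_def algebra_simps add_divide_distrib)
    qed
    have "D \<le> 0"
    proof (rule LIMSEQ_le_const[of "\<lambda>n. 2 / real n * A"])
      have "(\<lambda>n. 2 * (1 / real n) * A) \<longlonglongrightarrow> 2 * 0 * A"
        by (intro tendsto_intros lim_1_over_n)
      then show "(\<lambda>n. 2 / real n * A) \<longlonglongrightarrow> 0" by simp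
      show "\<exists>N. \<forall>n\<ge>N. D \<le> 2 / real n * A"
        using bound by (intro exI[of _ 1]) auto
    qed
    then show ?thesis by (simp add: D_def)
  qed
  with intM have "has_bochner_integral M (\<lambda>x. x ^ r) (m r)" for r
    by (simp add: has_bochner_integral_iff)
  with M show ?thesis by (rule that)
qed

lemma (in birth_death) distr_chain:
  fixes f :: "nat \<Rightarrow> nat \<Rightarrow> real"
  shows "real_distribution (distr (chain k) borel (\<lambda>(w, d). f w d))"
    and "integrable (distr (chain k) borel (\<lambda>(w, d). f w d)) (\<lambda>x. x ^ r)"
    and "(\<integral>x. x ^ r \<partial>distr (chain k) borel (\<lambda>(w, d). f w d)) = E k (\<lambda>w d. f w d ^ r)"
  by (auto simp: integrable_distr_eq integral_distr integrable_measure_pmf_finite finite_set_pmf_chain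
      E_def case_prod_unfold intro!: prob_space.real_distribution_distr prob_space_measure_pmf)

text \<open>The Mittag-Leffler law is the limit law of the pure birth chain with rate \<open>\<alpha>\<close> (the number of
  tables in a Chinese restaurant process).\<close>

lemma mittag_leffler_exists:
  assumes "0 < \<alpha>" "\<alpha> < 1"
  obtains M where "mittag_leffler \<alpha> M"
proof -
  interpret birth_death \<alpha> 0 1 1 0
    using assms by unfold_locales auto
  define \<mu> where "\<mu> k = distr (chain k) borel (\<lambda>(w, d). real w / real k powr \<alpha>)" for k
  \<comment> \<open>For b = 0 the generating function at w = 1 is 1 / (1 - \<alpha> y). The
    resulting power cancels \<open>(a - b) ^ r\<close> in \<open>E_power_asymp\<close>, which leaves
    exactly the Mittag-Leffler moments.\<close>
  have eig: "eigenfun r 1 = \<alpha> ^ r" for r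
    using eigenfun_Suc_1 by (cases r) (simp_all add: eigenfun_0_left)
  have "(\<lambda>k. \<integral>x. x ^ r \<partial>\<mu> k) \<longlonglongrightarrow> fact r / Gamma (real r * \<alpha> + 1)" for r
  proof -
    have "\<forall>\<^sub>F k in sequentially. E k (\<lambda>w d. real w ^ r) / real k powr (real r * \<alpha>) = (\<integral>x. x ^ r \<partial>\<mu> k)"
      using eventually_gt_at_top[of 0]
    proof eventually_elim
      case (elim k)
      have "(real w / real k powr \<alpha>) ^ r = 1 / real k powr (real r * \<alpha>) * real w ^ r" for w
        using elim by (simp add: power_divide powr_realpow[symmetric] powr_powr powr_gt_zero mult.commute)
      then show ?case
        unfolding \<mu>_def distr_chain by (simp only: E_cmult) simp
    qed
    moreover have "(\<lambda>k. E k (\<lambda>w d. real w ^ r) / real k powr (real r * \<alpha>)) \<longlonglongrightarrow> fact r / Gamma (real r * \<alpha> + 1)"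
      using E_power_asymp[of r] assms unfolding eig by (simp add: add.commute)
    ultimately show ?thesis
      by (rule Lim_transform_eventually[rotated])
  qed
  then show ?thesis
  proof (rule exists_moment_limit[rotated 2])
    show "real_distribution (\<mu> n)" "integrable (\<mu> n) (\<lambda>x. x ^ r)" for n r
      unfolding \<mu>_def by (rule distr_chain)+
  next
    fix M
    assume "real_distribution M" "\<And>r. has_bochner_integral M (\<lambda>x. x ^ r) (fact r / Gamma (real r * \<alpha> + 1))"
    then show thesis by (intro that[of M]) (simp add: mittag_leffler_def)
  qed
qed

section \<open>Absorption and ballot numbers\<close>

text \<open>On the naturals a distribution function is a finite sum of point probabilities, so it
  converges at every point.\<close>

lemma weak_conv_m_nat_pmf:
  fixes P :: "nat \<Rightarrow> nat pmf"
  assumes "\<And>m. (\<lambda>n. pmf (P n) m) \<longlonglongrightarrow> pmf D m"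
  shows "weak_conv_m (\<lambda>n. distr (P n) borel real) (distr D borel real)"
  unfolding weak_conv_m_def weak_conv_def
proof (intro allI impI)
  fix x :: real
  have fin: "finite {m::nat. real m \<le> x}"
  proof (rule finite_subset)
    show "{m. real m \<le> x} \<subseteq> {..nat \<lfloor>x\<rfloor>}" by (auto simp: le_nat_floor)
  qed simp
  have cdf: "cdf (distr Q borel real) x = (\<Sum>m | real m \<le> x. pmf Q m)" for Q :: "nat pmf"
    using fin by (simp add: cdf_def measure_distr vimage_def measure_measure_pmf_finite)
  show "(\<lambda>n. cdf (distr (P n) borel real) x) \<longlonglongrightarrow> cdf (distr D borel real) x"
    unfolding cdf by (intro tendsto_sum assms)
qed

text \<open>Read x as the probability of a state of weight c, y as the inflow and c x / (k + 2) as
  the outflow. Telescoping makes the outflow summable and x convergent; a positive limit of x would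
  make the harmonic series converge. Hence everything that enters the state leaves it again.\<close>

lemma harmonic_absorption:
  fixes x y :: "nat \<Rightarrow> real"
  assumes rec: "\<And>k. x (Suc k) = (1 - c / real (k + 2)) * x k + y k"
    and c: "c > 0" and x: "\<And>k. 0 \<le> x k" and y: "\<And>k. 0 \<le> y k" "y sums S"
  shows "(\<lambda>k. c / real (k + 2) * x k) sums (x 0 + S)" "x \<longlonglongrightarrow> 0"
proof -
  define z where "z k = c / real (k + 2) * x k" for k
  have z: "0 \<le> z k" for k using c x by (simp add: z_def)
  have tele: "(\<Sum>k<n. z k) = x 0 + (\<Sum>k<n. y k) - x n" for n
    by (induction n) (auto simp: rec z_def algebra_simps)
  have "summable z"
  proof (rule summableI_nonneg_bounded[OF z])
    fix n
    have "(\<Sum>k<n. y k) \<le> S"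
      using sums_unique[OF y(2)] sum_le_suminf[OF sums_summable[OF y(2)], of "{..<n}"] y(1) by auto
    then show "(\<Sum>k<n. z k) \<le> x 0 + S" using x[of n] by (simp add: tele)
  qed
  then have zlim: "(\<lambda>n. \<Sum>k<n. z k) \<longlonglongrightarrow> suminf z"
    by (rule summable_LIMSEQ)
  define l where "l = x 0 + S - suminf z"
  have "(\<lambda>n. x 0 + (\<Sum>k<n. y k) - (\<Sum>k<n. z k)) \<longlonglongrightarrow> l"
    unfolding l_def using y(2) zlim by (intro tendsto_intros) (simp_all add: sums_def)
  then have xl: "x \<longlonglongrightarrow> l" by (simp add: tele)
  have "l \<ge> 0" using x by (intro LIMSEQ_le_const[OF xl]) auto
  moreover have False if "l > 0"
  proof -
    have "\<forall>\<^sub>F k in sequentially. x k > l / 2"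
      using that by (intro order_tendstoD(1)[OF xl]) simp
    then have "\<forall>\<^sub>F k in sequentially. norm (inverse (real (k + 2))) \<le> 2 / (c * l) * z k"
    proof eventually_elim
      case (elim k)
      then have "inverse (real (k + 2)) * (l / 2) \<le> inverse (real (k + 2)) * x k"
        by (intro mult_left_mono) auto
      then have "2 / l * (inverse (real (k + 2)) * (l / 2)) \<le> 2 / l * (inverse (real (k + 2)) * x k)"
        using that by (intro mult_left_mono) auto
      also have "\<dots> = 2 / (c * l) * z k"
        using c by (simp add: z_def field_simps)
      finally show ?case using that by (simp del: of_nat_add)
    qed
    then have "summable (\<lambda>k. inverse (real (k + 2)))"
      by (rule summable_comparison_test_ev) (rule summable_mult[OF \<open>summable z\<close>])
    then have "summable (\<lambda>k. inverse (real k))"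
      by (rule iffD1[OF summable_iff_shift])
    then show False
      using not_summable_harmonic[where 'a = real] by contradiction
  qed
  ultimately have "l = 0" by fastforce
  then show "x \<longlonglongrightarrow> 0" using xl by simp
  show "(\<lambda>k. c / real (k + 2) * x k) sums (x 0 + S)"
    using \<open>summable z\<close> \<open>l = 0\<close> unfolding z_def[symmetric] by (simp add: l_def sums_iff)
qed

section \<open>Forward equations and exponential invariants\<close>

context birth_death
begin

lemma pmf_chain_eq_E: "pmf (chain k) (w, d) = E k (\<lambda>w' d'. if w' = w \<and> d' = d then 1 else 0)"
proof -
  have "pmf (chain k) (w, d) = measure_pmf.expectation (chain k) (indicator {(w, d)})"
    by (simp add: measure_pmf_single)
  also have "\<dots> = E k (\<lambda>w' d'. if w' = w \<and> d' = d then 1 else 0)"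
    unfolding E_def by (intro arg_cong[of _ _ "integral\<^sup>L _"]) (auto simp: fun_eq_iff indicator_def)
  finally show ?thesis .
qed

text \<open>The forward equation, obtained by applying the generator to the indicator of one state.
  The factor \<open>real w'\<close> in front of the shifted indicators removes the spurious
  predecessor 0 created by truncated subtraction.\<close>

lemma pmf_chain_Suc:
  "pmf (chain (Suc k)) (w, d) = (1 - (a + b) * real w / real (m + k)) * pmf (chain k) (w, d)
     + (if w = 0 \<or> d = 0 then 0 else a * real (w - 1) / real (m + k) * pmf (chain k) (w - 1, d - 1))
     + b * real (w + 1) / real (m + k) * pmf (chain k) (w + 1, d)"
proof -
  let ?I = "\<lambda>w d w' d'. if w' = w \<and> d' = d then 1 else 0 :: real"
  have "pmf (chain (Suc k)) (w, d) = E k (\<lambda>w' d'. ?I w d w' d' + real w' / real (m + k) *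
      (a * (?I w d (w' + 1) (d' + 1) - ?I w d w' d') + b * (?I w d (w' - 1) d' - ?I w d w' d')))"
    unfolding pmf_chain_eq_E E_Suc ..
  also have "\<dots> = E k (\<lambda>w' d'. (1 - (a + b) * real w / real (m + k)) * ?I w d w' d'
     + (if w = 0 \<or> d = 0 then 0 else a * real (w - 1) / real (m + k)) * ?I (w - 1) (d - 1) w' d'
     + b * real (w + 1) / real (m + k) * ?I (w + 1) d w' d')"
  proof (rule E_cong)
    fix w' d'
    have "real w' * ?I w d w' d' = real w * ?I w d w' d'"
      and "real w' * ?I w d (w' + 1) (d' + 1) = (if w = 0 \<or> d = 0 then 0 else real (w - 1)) * ?I (w - 1) (d - 1) w' d'"
      and "real w' * ?I w d (w' - 1) d' = real (w + 1) * ?I (w + 1) d w' d'"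
      by auto
    moreover have "?I w d w' d' + real w' / real (m + k) *
      (a * (?I w d (w' + 1) (d' + 1) - ?I w d w' d') + b * (?I w d (w' - 1) d' - ?I w d w' d'))
      = ?I w d w' d' + (a * (real w' * ?I w d (w' + 1) (d' + 1)) + b * (real w' * ?I w d (w' - 1) d')
          - (a + b) * (real w' * ?I w d w' d')) / real (m + k)"
      by (simp only: algebra_simps add_divide_distrib diff_divide_distrib times_divide_eq_left times_divide_eq_right)
    ultimately show "?I w d w' d' + real w' / real (m + k) *
      (a * (?I w d (w' + 1) (d' + 1) - ?I w d w' d') + b * (?I w d (w' - 1) d' - ?I w d w' d'))
      = (1 - (a + b) * real w / real (m + k)) * ?I w d w' d'
     + (if w = 0 \<or> d = 0 then 0 else a * real (w - 1) / real (m + k)) * ?I (w - 1) (d - 1) w' d'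
     + b * real (w + 1) / real (m + k) * ?I (w + 1) d w' d'"
      by (simp only:) (simp add: algebra_simps add_divide_distrib diff_divide_distrib)
  qed
  finally show ?thesis
    unfolding E_add E_cmult pmf_chain_eq_E by simp
qed

text \<open>An up-step raises both coordinates and a down-step lowers only the weight, so w - d
  never exceeds its initial value. A given d therefore leaves only finitely many weights.\<close>

lemma set_pmf_chain_d: "s \<in> set_pmf (chain k) \<Longrightarrow> d0 \<le> snd s \<and> fst s + d0 \<le> w0 + snd s"
proof (induction k arbitrary: s)
  case (Suc k)
  then obtain s' where "s' \<in> set_pmf (chain k)" "s \<in> set_pmf (bd_step a b (m + k) s')"
    by auto
  with Suc.IH[of s'] show ?case
    by (cases s') (auto simp: bd_step_def split: if_splits)
qed auto

lemma pmf_snd_chain: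
  assumes "w0 + d \<le> W + d0"
  shows "pmf (map_pmf snd (chain k)) d = (\<Sum>w\<le>W. pmf (chain k) (w, d))"
proof -
  have "pmf (map_pmf snd (chain k)) d = measure (chain k) (snd -` {d} \<inter> set_pmf (chain k))"
    by (simp add: pmf_map measure_Int_set_pmf)
  also have "snd -` {d} \<inter> set_pmf (chain k) = (\<lambda>w. (w, d)) ` {..W} \<inter> set_pmf (chain k)"
    using assms set_pmf_chain_d[of _ k] by fastforce
  also have "measure (chain k) \<dots> = (\<Sum>s\<in>(\<lambda>w. (w, d)) ` {..W}. pmf (chain k) s)"
    by (simp add: measure_Int_set_pmf measure_measure_pmf_finite)
  also have "\<dots> = (\<Sum>w\<le>W. pmf (chain k) (w, d))"
    by (subst sum.reindex) (auto simp: inj_on_def)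
  finally show ?thesis .
qed

text \<open>For w > 0 the increments of s^d x^w, weighted by their rates, sum to s^d x^(w-1) times
  the difference of the two sides of the assumption; at w = 0 nothing moves.\<close>

lemma exponential_invariant:
  assumes "s * a * x\<^sup>2 + b = (a + b) * x" "x > 0"
  shows "E k (\<lambda>w d. s ^ d * x ^ w) = s ^ d0 * x ^ w0"
proof (rule E_invariant)
  fix w d
  show "real w * (a * (s ^ (d + 1) * x ^ (w + 1) - s ^ d * x ^ w) + b * (s ^ d * x ^ (w - 1) - s ^ d * x ^ w)) = 0"
  proof (cases w)
    case (Suc v)
    have "a * (s ^ (d + 1) * x ^ (w + 1) - s ^ d * x ^ w) + b * (s ^ d * x ^ (w - 1) - s ^ d * x ^ w)
      = s ^ d * x ^ v * (s * a * x\<^sup>2 + b - (a + b) * x)"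
      by (simp add: Suc algebra_simps power2_eq_square)
    then show ?thesis using assms(1) by simp
  qed simp
qed

text \<open>The conserved function is at most 1 for d \<le> K and at most s^(K+1) beyond. Its
  constant mean thus bounds the probability of d \<le> K from below, uniformly in time.\<close>

lemma exponential_le_cdf:
  assumes "s * a * x\<^sup>2 + b = (a + b) * x" "0 < x" "x \<le> 1" "0 \<le> s" "s \<le> 1"
  shows "s ^ d0 * x ^ w0 \<le> (\<Sum>d\<le>K. pmf (map_pmf snd (chain k)) d) + s ^ Suc K"
proof -
  have "s ^ d0 * x ^ w0 = E k (\<lambda>w d. s ^ d * x ^ w)"
    using exponential_invariant[OF assms(1,2)] by simp
  also have "\<dots> \<le> E k (\<lambda>w d. (if d \<le> K then 1 else 0) + s ^ Suc K)"
  proof (rule E_mono)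
    fix w d
    have "s ^ d * x ^ w \<le> s ^ d" using assms by (intro mult_right_le_one_le power_le_one) auto
    also have "\<dots> \<le> (if d \<le> K then 1 else 0) + s ^ Suc K"
      using assms power_decreasing[of "Suc K" d s] by (auto intro!: add_increasing2 power_le_one)
    finally show "s ^ d * x ^ w \<le> (if d \<le> K then 1 else 0) + s ^ Suc K" .
  qed
  also have "\<dots> = E k (\<lambda>w d. if d \<le> K then 1 else 0) + s ^ Suc K"
    by (simp only: E_add E_const)
  also have "E k (\<lambda>w d. if d \<le> K then 1 else 0) = measure_pmf.expectation (chain k) (indicator (snd -` {..K}))"
    unfolding E_def by (intro arg_cong[of _ _ "integral\<^sup>L _"]) (auto simp: fun_eq_iff indicator_def)
  also have "\<dots> = measure (map_pmf snd (chain k)) {..K}"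
    by simp
  also have "\<dots> = (\<Sum>d\<le>K. pmf (map_pmf snd (chain k)) d)"
    by (rule measure_measure_pmf_finite) simp
  finally show ?thesis .
qed

end

text \<open>The number of lattice paths from height 2 with \<open>u\<close> up-steps and \<open>v\<close> down-steps that stay
  positive, by the reflection principle.\<close>

definition ballot :: "nat \<Rightarrow> nat \<Rightarrow> real" where
  "ballot u v = real ((u + v) choose u) - real ((u + v) choose (u + 2))"

lemma ballot_Suc_Suc: "ballot (Suc u) (Suc v) = ballot u (Suc v) + ballot (Suc u) v"
  by (simp add: ballot_def numeral_2_eq_2)

lemma ballot_0_right: "ballot u 0 = 1"
  by (simp add: ballot_def binomial_eq_0)

lemma ballot_0_1: "ballot 0 1 = 1"
  by (simp add: ballot_def binomial_eq_0)

text \<open>With u + 2 down-steps the path ends at height 0, so none stays positive: the boundary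
  value for the recurrence.\<close>

lemma ballot_diagonal: "ballot u (u + 2) = 0"
  using binomial_symmetric[of u "u + (u + 2)"] by (simp add: ballot_def)

text \<open>Both binomials are multiples of (2u+1 choose u): the larger central one is twice it, and
  (2u+1 choose u+2) is u / (u + 2) times it. The result is the Catalan number of index u +
  1.\<close>

lemma ballot_catalan: "ballot u (u + 1) = 1 / (real u + 2) * real ((2 * (u + 1)) choose (u + 1))"
proof -
  have 1: "(2 * (u + 1)) choose (u + 1) = 2 * ((2 * u + 1) choose u)"
    using binomial_symmetric[of u "2 * u + 1"] by (simp add: mult_2)
  have "Suc (Suc u) * ((2 * u + 1) choose Suc (Suc u)) = (2 * u + 1 - Suc u) * ((2 * u + 1) choose Suc u)"
    using binomial_absorption[of "Suc u" "2 * u + 1"] binomial_absorb_comp[of "2 * u + 1" "Suc u"] by simp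
  also have "\<dots> = u * ((2 * u + 1) choose u)"
    using binomial_symmetric[of u "2 * u + 1"] by simp
  finally have "real (Suc (Suc u)) * real ((2 * u + 1) choose Suc (Suc u)) = real u * real ((2 * u + 1) choose u)"
    by (metis of_nat_mult)
  moreover have "ballot u (u + 1) = real ((2 * u + 1) choose u) - real ((2 * u + 1) choose Suc (Suc u))"
    by (simp only: ballot_def mult_2 add.assoc add_2_eq_Suc')
  moreover have "x - y = 1 / (real u + 2) * (2 * x)" if "real (Suc (Suc u)) * y = real u * x" for x y :: real
    using that by (simp add: field_simps)
  ultimately show ?thesis
    unfolding 1 by simp
qed

section \<open>The limit law of the source degree\<close>

locale saturation =
  fixes p :: real
  assumes p_pos: "0 < p" and p_less_1: "p < 1"
begin

sublocale birth_death p "1 - p" 2 2 "Suc 0"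
  using p_pos p_less_1 by unfold_locales auto

lemma pmf_chain_eq_0: "d = 0 \<or> w > d + 1 \<Longrightarrow> pmf (chain k) (w, d) = 0"
  by (rule ccontr) (use set_pmf_chain_d[of "(w, d)" k] in \<open>auto simp: set_pmf_iff\<close>)

text \<open>After u up-steps and v down-steps the state is (2 + u - v, u + 1). The total outflow of
  this state equals the probability that the walk without its waiting times visits it, namely the
  number of positive paths times the weight of one path. Induction on u + v feeds the outflow of the
  two predecessors into \<open>harmonic_absorption\<close>.\<close>

lemma pmf_chain_positive_weight:
  assumes "v \<le> u + 1"
  shows "(\<lambda>k. real (2 + u - v) / real (k + 2) * pmf (chain k) (2 + u - v, u + 1))
      sums (p ^ u * (1 - p) ^ v * ballot u v)"
    and "(\<lambda>k. pmf (chain k) (2 + u - v, u + 1)) \<longlonglongrightarrow> 0"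
proof -
  have "(\<lambda>k. real (2 + u - v) / real (k + 2) * pmf (chain k) (2 + u - v, u + 1))
      sums (p ^ u * (1 - p) ^ v * ballot u v) \<and> (\<lambda>k. pmf (chain k) (2 + u - v, u + 1)) \<longlonglongrightarrow> 0"
    using assms
  proof (induction "u + v" arbitrary: u v rule: less_induct)
    case less
    define c where "c = real (2 + u - v)"
    define x where "x k = pmf (chain k) (2 + u - v, u + 1)" for k
    \<comment> \<open>\<open>y1\<close> is the inflow through an up-step, \<open>y2\<close> the
      inflow through a down-step.\<close>
    define y1 where "y1 k = p * (real (1 + u - v) / real (k + 2) * pmf (chain k) (1 + u - v, u))" for k
    define y2 where "y2 k = (1 - p) * (real (3 + u - v) / real (k + 2) * pmf (chain k) (3 + u - v, u + 1))" for k
    define S1 where "S1 = (if u = 0 then 0 else p * (p ^ (u - 1) * (1 - p) ^ v * ballot (u - 1) v))"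
    define S2 where "S2 = (if v = 0 then 0 else (1 - p) * (p ^ u * (1 - p) ^ (v - 1) * ballot u (v - 1)))"
    have c: "c > 0" using less.prems by (simp add: c_def)
    have rec: "x (Suc k) = (1 - c / real (k + 2)) * x k + (y1 k + y2 k)" for k
    proof -
      have "2 + u - v - 1 = 1 + u - v" "2 + u - v + 1 = 3 + u - v" "2 + u - v \<noteq> 0"
        using less.prems by auto
      then show ?thesis
        unfolding x_def pmf_chain_Suc c_def y1_def y2_def by (simp add: add.commute)
    qed
    have y1: "y1 sums S1"
    proof (cases u)
      case 0
      then have "y1 = (\<lambda>_. 0)" by (auto simp: y1_def pmf_chain_eq_0)
      then show ?thesis using 0 by (simp add: S1_def)
    next
      case (Suc u')
      show ?thesis
      proof (cases "v \<le> u' + 1")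
        case True
        then show ?thesis
          using sums_mult[OF conjunct1[OF less.hyps[of u' v]], of p] unfolding y1_def S1_def Suc by simp
      next
        case False
        \<comment> \<open>Here the predecessor has weight 0, so it is absorbed and sends nothing on,
          in agreement with \<open>ballot_diagonal\<close>.\<close>
        then have v: "v = u' + 2" using less.prems Suc by simp
        have "y1 = (\<lambda>_. 0)" by (auto simp: y1_def v Suc)
        then show ?thesis using ballot_diagonal[of u'] by (simp add: S1_def v Suc)
      qed
    qed
    have y2: "y2 sums S2"
    proof (cases v)
      case 0
      then have "y2 = (\<lambda>_. 0)" by (auto simp: y2_def pmf_chain_eq_0)
      then show ?thesis using 0 by (simp add: S2_def)
    next
      case (Suc v')
      have "3 + u - Suc v' = 2 + u - v'" by simp
      then show ?thesis
        using sums_mult[OF conjunct1[OF less.hyps[of u v']], of "1 - p"] less.prems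
        unfolding y2_def S2_def Suc by simp
    qed
    have total: "x 0 + (S1 + S2) = p ^ u * (1 - p) ^ v * ballot u v"
    proof (cases u)
      case 0
      then have "v = 0 \<or> v = 1" using less.prems by auto
      then show ?thesis
        using 0 by (auto simp: x_def S1_def S2_def ballot_0_right ballot_0_1[simplified] indicator_def)
    next
      case (Suc u')
      then have "x 0 = 0" by (simp add: x_def)
      then show ?thesis
        by (cases v) (simp_all add: S1_def S2_def Suc ballot_0_right ballot_Suc_Suc algebra_simps)
    qed
    have nn: "0 \<le> x k" "0 \<le> y1 k + y2 k" for k
      using p_pos p_less_1 by (auto simp: x_def y1_def y2_def)
    show ?case
      using harmonic_absorption[OF rec c nn sums_add[OF y1 y2]] unfolding total
      by (simp add: c_def x_def[abs_def])
  qed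
  then show "(\<lambda>k. real (2 + u - v) / real (k + 2) * pmf (chain k) (2 + u - v, u + 1))
      sums (p ^ u * (1 - p) ^ v * ballot u v)"
    and "(\<lambda>k. pmf (chain k) (2 + u - v, u + 1)) \<longlonglongrightarrow> 0" by auto
qed

text \<open>Weight 0 is entered only from weight 1, by a down-step, and never left; its probability
  is thus 1 - p times the accumulated outflow of (1, u + 1).\<close>

lemma pmf_chain_absorbed:
  "(\<lambda>k. pmf (chain k) (0, u + 1)) \<longlonglongrightarrow> p ^ u * (1 - p) ^ (u + 2) * ballot u (u + 1)"
proof -
  \<comment> \<open>This is the case v = u + 1, written out so that
    \<open>pmf_chain_positive_weight\<close> applies; the weight is 1.\<close>
  define z where "z k = real (2 + u - (u + 1)) / real (k + 2) * pmf (chain k) (2 + u - (u + 1), u + 1)" for k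
  have eq: "pmf (chain k) (0, u + 1) = (1 - p) * (\<Sum>j<k. z j)" for k
  proof (induction k)
    case (Suc k)
    then show ?case
      unfolding pmf_chain_Suc by (simp add: z_def algebra_simps)
  qed simp
  have "z sums (p ^ u * (1 - p) ^ (u + 1) * ballot u (u + 1))"
    unfolding z_def by (rule pmf_chain_positive_weight) simp
  then have "(\<lambda>k. (1 - p) * (\<Sum>j<k. z j)) \<longlonglongrightarrow> (1 - p) * (p ^ u * (1 - p) ^ (u + 1) * ballot u (u + 1))"
    unfolding sums_def by (intro tendsto_intros)
  then show ?thesis
    unfolding eq by (simp add: mult_ac)
qed

text \<open>For degree d the weight is at most d + 1, and in the limit the states of positive weight
  carry no mass, so only the absorbed state contributes.\<close>

lemma pmf_source_degree_tendsto:
  assumes "d \<ge> 1"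
  shows "(\<lambda>k. pmf (map_pmf snd (chain k)) d)
    \<longlonglongrightarrow> 1 / (real d + 1) * real ((2 * d) choose d) * p ^ (d - 1) * (1 - p) ^ (d + 1)"
proof -
  obtain u where d: "d = u + 1" using assms by (metis Suc_eq_plus1 Suc_le_D One_nat_def)
  have "(\<lambda>k. \<Sum>w\<le>u + 2. pmf (chain k) (w, u + 1))
    \<longlonglongrightarrow> (\<Sum>w\<le>u + 2. if w = 0 then p ^ u * (1 - p) ^ (u + 2) * ballot u (u + 1) else 0)"
  proof (rule tendsto_sum)
    fix w assume w: "w \<in> {..u + 2}"
    show "(\<lambda>k. pmf (chain k) (w, u + 1)) \<longlonglongrightarrow> (if w = 0 then p ^ u * (1 - p) ^ (u + 2) * ballot u (u + 1) else 0)"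
    proof (cases "w = 0")
      case False
      then have "2 + u - (2 + u - w) = w" using w by auto
      then show ?thesis
        using False pmf_chain_positive_weight(2)[of "2 + u - w" u] by simp
    qed (use pmf_chain_absorbed in simp)
  qed
  then have "(\<lambda>k. pmf (map_pmf snd (chain k)) d) \<longlonglongrightarrow> p ^ u * (1 - p) ^ (u + 2) * ballot u (u + 1)"
    by (subst pmf_snd_chain[of d "u + 2"]) (simp_all add: d)
  also have "p ^ u * (1 - p) ^ (u + 2) * ballot u (u + 1)
     = 1 / (real d + 1) * real ((2 * d) choose d) * p ^ (d - 1) * (1 - p) ^ (d + 1)"
    unfolding ballot_catalan d by (simp add: add_ac)
  finally show ?thesis .
qed

text \<open>The limits of the point probabilities have total mass at most 1. The exponential
  invariant shows that no mass escapes to infinity, so they form a distribution.\<close>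

lemma source_degree_converges_subcritical:
  assumes "p \<le> 1 / 2"
  shows "\<exists>D :: nat pmf.
    (\<forall>m\<ge>1. pmf D m = 1 / (real m + 1) * real ((2 * m) choose m) * p ^ (m - 1) * (1 - p) ^ (m + 1)) \<and>
    weak_conv_m (\<lambda>n. distr (source_degree_pmf p n) borel real) (distr D borel real)"
proof -
  define c where "c d = (if d = 0 then 0 else
    1 / (real d + 1) * real ((2 * d) choose d) * p ^ (d - 1) * (1 - p) ^ (d + 1))" for d :: nat
  have c_nonneg: "0 \<le> c d" for d
    using p_pos p_less_1 by (simp add: c_def)
  have lim: "(\<lambda>k. pmf (map_pmf snd (chain k)) d) \<longlonglongrightarrow> c d" for d
  proof (cases "d = 0")
    case True
    have "pmf (map_pmf snd (chain k)) 0 = 0" for k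
      by (subst pmf_snd_chain[of 0 1]) (simp_all add: pmf_chain_eq_0)
    then show ?thesis using True by (simp add: c_def)
  qed (use pmf_source_degree_tendsto[of d] in \<open>simp add: c_def\<close>)
  have limsum: "(\<lambda>k. \<Sum>d\<le>K. pmf (map_pmf snd (chain k)) d) \<longlonglongrightarrow> (\<Sum>d\<le>K. c d)" for K
    by (intro tendsto_sum lim)
  have le1: "(\<Sum>d\<le>K. c d) \<le> 1" for K
  proof (rule LIMSEQ_le_const2[OF limsum])
    show "\<exists>N. \<forall>k\<ge>N. (\<Sum>d\<le>K. pmf (map_pmf snd (chain k)) d) \<le> 1"
      by (auto simp: measure_measure_pmf_finite[symmetric] measure_pmf.prob_le_1 simp del: measure_map_pmf)
  qed
  have summ: "summable c"
  proof (rule summableI_nonneg_bounded[OF c_nonneg])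
    fix n
    have "(\<Sum>d<n. c d) \<le> (\<Sum>d\<le>n. c d)"
      by (intro sum_mono2) (auto simp: c_nonneg)
    also have "\<dots> \<le> 1" by (rule le1)
    finally show "(\<Sum>d<n. c d) \<le> 1" .
  qed
  have partial: "(\<lambda>K. \<Sum>d\<le>K. c d) \<longlonglongrightarrow> suminf c"
    using summable_LIMSEQ'[OF summ] .
  have le: "suminf c \<le> 1"
    using le1 by (intro LIMSEQ_le_const2[OF partial]) auto
  \<comment> \<open>The choice of s makes s^d x^w invariant, with initial value s x^2 = (x - (1 -
    p)) / p. First the time and then K tend to infinity; afterwards x tends to 1 from below, where
    this bound becomes 1.\<close>
  have ge: "(x - (1 - p)) / p \<le> suminf c" if x: "1 - p < x" "x < 1" for x
  proof -
    define s where "s = (x - (1 - p)) / (p * x\<^sup>2)"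
    have x0: "x > 0" using x p_less_1 by linarith
    have s0: "s \<ge> 0" using x x0 p_pos by (simp add: s_def)
    \<comment> \<open>The assumption p \<le> 1/2 enters here: s < 1 amounts to (1 - x) (1 - p - p x)
      > 0.\<close>
    have "p * x < 1 - p"
      using assms x p_pos mult_strict_left_mono[of x 1 p] by linarith
    then have "0 < (1 - x) * (1 - p - p * x)" using x by simp
    then have s1: "s < 1" using x0 p_pos by (simp add: s_def field_simps power2_eq_square)
    have inv: "s * p * x\<^sup>2 + (1 - p) = (p + (1 - p)) * x"
      using x0 p_pos by (simp add: s_def)
    have "s ^ 1 * x ^ 2 \<le> (\<Sum>d\<le>K. c d) + s ^ Suc K" for K
    proof (rule LIMSEQ_le_const[OF tendsto_add[OF limsum tendsto_const]])
      show "\<exists>N. \<forall>k\<ge>N. s ^ 1 * x ^ 2 \<le> (\<Sum>d\<le>K. pmf (map_pmf snd (chain k)) d) + s ^ Suc K"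
        using exponential_le_cdf[OF inv] x x0 s0 s1 by auto
    qed
    moreover have "(\<lambda>K. (\<Sum>d\<le>K. c d) + s ^ Suc K) \<longlonglongrightarrow> suminf c + 0"
      using s0 s1 by (intro tendsto_add partial LIMSEQ_Suc LIMSEQ_power_zero) simp
    ultimately have "s ^ 1 * x ^ 2 \<le> suminf c + 0"
      by (intro LIMSEQ_le_const) auto
    then show ?thesis using x0 p_pos by (simp add: s_def)
  qed
  have "1 \<le> suminf c"
  proof (rule tendsto_upperbound)
    show "((\<lambda>x. (x - (1 - p)) / p) \<longlongrightarrow> 1) (at_left 1)"
      using p_pos by (auto intro!: tendsto_eq_intros)
    have "\<forall>\<^sub>F x in at_left 1. x \<in> {1 - p<..<1}"
      using p_pos by (intro eventually_at_leftI[of "1 - p"]) auto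
    then show "\<forall>\<^sub>F x in at_left 1. (x - (1 - p)) / p \<le> suminf c"
      by eventually_elim (use ge in auto)
  qed simp
  with le have total: "suminf c = 1" by simp
  define D where "D = embed_pmf c"
  have D: "pmf D m = c m" for m
    unfolding D_def
  proof (rule pmf_embed_pmf[OF c_nonneg])
    show "(\<integral>\<^sup>+x. ennreal (c x) \<partial>count_space UNIV) = 1"
      using suminf_ennreal2[OF c_nonneg summ] total by (simp add: nn_integral_count_space_nat)
  qed
  \<comment> \<open>Size k + 1 belongs to time k of the chain; the shift also skips the dummy size
    0.\<close>
  have "(\<lambda>n. pmf (source_degree_pmf p n) m) \<longlonglongrightarrow> pmf D m" for m
    by (rule LIMSEQ_imp_Suc) (use lim in \<open>simp add: source_degree_pmf_eq D\<close>)
  then have "weak_conv_m (\<lambda>n. distr (source_degree_pmf p n) borel real) (distr D borel real)"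
    by (rule weak_conv_m_nat_pmf)
  then show ?thesis
    by (intro exI[of _ D]) (simp add: D c_def)
qed

end

section \<open>Independent pairs as coordinates of a product space\<close>

lemma real_distributions_product:
  assumes M1: "real_distribution M1" and M2: "real_distribution M2"
  shows "prob_space (M1 \<Otimes>\<^sub>M M2)"
    and "distr (M1 \<Otimes>\<^sub>M M2) borel fst = M1" "distr (M1 \<Otimes>\<^sub>M M2) borel snd = M2"
    and "prob_space.indep_var (M1 \<Otimes>\<^sub>M M2) borel fst borel snd"
proof -
  interpret M1: real_distribution M1 by fact
  interpret M2: real_distribution M2 by fact
  interpret pair_prob_space M1 M2 ..
  show prob: "prob_space (M1 \<Otimes>\<^sub>M M2)"
    by (rule prob_space_pair) unfold_locales
  have sets: "sets (M1 \<Otimes>\<^sub>M M2) = sets (borel \<Otimes>\<^sub>M borel)"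
    by (rule sets_pair_measure_cong) simp_all
  have fst: "distr (M1 \<Otimes>\<^sub>M M2) borel fst = distr (M1 \<Otimes>\<^sub>M M2) M1 fst"
    by (rule distr_cong) simp_all
  show 1: "distr (M1 \<Otimes>\<^sub>M M2) borel fst = M1"
    unfolding fst by (rule M2.distr_pair_fst)
  show 2: "distr (M1 \<Otimes>\<^sub>M M2) borel snd = M2"
  proof (rule measure_eqI)
    fix A assume "A \<in> sets (distr (M1 \<Otimes>\<^sub>M M2) borel snd)"
    then have A: "A \<in> sets borel" "A \<in> sets M2" by simp_all
    have "emeasure (distr (M1 \<Otimes>\<^sub>M M2) borel snd) A = emeasure (M1 \<Otimes>\<^sub>M M2) (space M1 \<times> A)"
      using A by (subst emeasure_distr)
        (auto simp: space_pair_measure measurable_cong_sets[OF sets refl] intro!: arg_cong2[where f = emeasure])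
    also have "\<dots> = emeasure M2 A"
      using A M1.emeasure_space_1 by (simp add: M2.emeasure_pair_measure_Times)
    finally show "emeasure (distr (M1 \<Otimes>\<^sub>M M2) borel snd) A = emeasure M2 A" .
  qed simp
  have "distr (M1 \<Otimes>\<^sub>M M2) (borel \<Otimes>\<^sub>M borel) (\<lambda>x. (fst x, snd x)) = M1 \<Otimes>\<^sub>M M2"
    using distr_id2[OF sets[symmetric]] by simp
  then show "prob_space.indep_var (M1 \<Otimes>\<^sub>M M2) borel fst borel snd"
    unfolding prob_space.indep_var_distribution_eq[OF prob]
    by (simp add: 1 2 measurable_cong_sets[OF sets refl])
qed

text \<open>Powers of independent variables are independent, so the moments of the product
  factor.\<close>

lemma moments_of_product:
  assumes M: "prob_space M" and ind: "prob_space.indep_var M borel B borel Y"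
    and int: "\<And>r. integrable M (\<lambda>\<omega>. B \<omega> ^ r)" "\<And>r. integrable M (\<lambda>\<omega>. Y \<omega> ^ r)"
  shows "real_distribution (distr M borel (\<lambda>\<omega>. B \<omega> * Y \<omega>))"
    and "integrable (distr M borel (\<lambda>\<omega>. B \<omega> * Y \<omega> :: real)) (\<lambda>x. x ^ r)"
    and "(\<integral>x. x ^ r \<partial>distr M borel (\<lambda>\<omega>. B \<omega> * Y \<omega>)) = (\<integral>\<omega>. B \<omega> ^ r \<partial>M) * (\<integral>\<omega>. Y \<omega> ^ r \<partial>M)"
proof -
  interpret prob_space M by fact
  have rv: "B \<in> borel_measurable M" "Y \<in> borel_measurable M"
    using ind indep_var_rv1 indep_var_rv2 by blast+
  then show "real_distribution (distr M borel (\<lambda>\<omega>. B \<omega> * Y \<omega>))"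
    by (intro real_distribution_distr) simp
  have "indep_var borel (\<lambda>\<omega>. B \<omega> ^ r) borel (\<lambda>\<omega>. Y \<omega> ^ r)"
    using indep_var_compose[OF ind, of "\<lambda>x. x ^ r" borel "\<lambda>x. x ^ r" borel] by (simp add: comp_def)
  note indep_var_integrable[OF this int(1)[of r] int(2)[of r]] indep_var_lebesgue_integral[OF this int(1)[of r] int(2)[of r]]
  with rv show "integrable (distr M borel (\<lambda>\<omega>. B \<omega> * Y \<omega>)) (\<lambda>x. x ^ r)"
    and "(\<integral>x. x ^ r \<partial>distr M borel (\<lambda>\<omega>. B \<omega> * Y \<omega>)) = (\<integral>\<omega>. B \<omega> ^ r \<partial>M) * (\<integral>\<omega>. Y \<omega> ^ r \<partial>M)"
    by (simp_all add: integrable_distr_eq integral_distr power_mult_distrib)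
qed

section \<open>The case p > 1/2\<close>

context saturation
begin

text \<open>The limits are the moments of B Y: a Bernoulli variable has the same mean for all its
  powers of positive exponent, which is why r = 0 stands apart.\<close>

lemma E_power_asymp_supercritical:
  assumes "p > 1 / 2"
  shows "(\<lambda>k. E k (\<lambda>w d. ((2 * p - 1) / p * (real w / real (Suc k) powr (2 * p - 1))) ^ r))
    \<longlonglongrightarrow> (if r = 0 then 1 else (2 * p - 1) / p\<^sup>2) * (fact r / Gamma (real r * (2 * p - 1) + 1))"
proof (cases "r = 0")
  case True
  then show ?thesis by (simp add: E_const)
next
  case False
  define \<alpha> where "\<alpha> = 2 * p - 1"
  have \<alpha>: "\<alpha> > 0" "p - (1 - p) = \<alpha>" using assms by (auto simp: \<alpha>_def)
  obtain r' where r: "r = Suc r'" using False by (cases r) auto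
  define L where "L = fact r / \<alpha> ^ r * (eigenfun r 2 * (Gamma (real 2) / Gamma (real 2 + real r * \<alpha>)))"
  have L: "(\<lambda>k. E k (\<lambda>w d. real w ^ r) / real k powr (real r * \<alpha>)) \<longlonglongrightarrow> L"
    using E_power_asymp[of r] assms unfolding L_def \<alpha>(2) by simp
  have pos: "real r * \<alpha> + 1 > 0" using \<alpha> by (intro add_nonneg_pos) auto
  then have "real r * \<alpha> + 1 \<notin> \<int>\<^sub>\<le>\<^sub>0"
    by (auto elim!: nonpos_Ints_cases)
  from Gamma_plus1[OF this]
  have "Gamma (real 2 + real r * \<alpha>) = (real r * \<alpha> + 1) * Gamma (real r * \<alpha> + 1)"
    by (simp add: add_ac)
  moreover note pos
  moreover have "Gamma (real 2) = 1" using Gamma_fact[of 1, where 'a = real] by simp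
  moreover have "eigenfun r 2 = \<alpha> * p ^ r' * (real r * \<alpha> + 1) / p"
    using eigenfun_Suc_2[of r'] unfolding \<alpha>(2) r by (simp add: algebra_simps)
  \<comment> \<open>The factor r \<alpha> + 1 of \<open>eigenfun r 2\<close> cancels against Gamma
    (2 + r \<alpha>) = (r \<alpha> + 1) Gamma (r \<alpha> + 1).\<close>
  ultimately have L_eq: "(\<alpha> / p) ^ r * L = \<alpha> / p\<^sup>2 * (fact r / Gamma (real r * \<alpha> + 1))"
    using \<alpha> p_pos by (simp add: L_def r power_divide power2_eq_square divide_simps)
  \<comment> \<open>The last factor passes from time k to size k + 1 in the normalisation.\<close>
  have "(\<lambda>k. (\<alpha> / p) ^ r * (E k (\<lambda>w d. real w ^ r) / real k powr (real r * \<alpha>))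
     * (real k / real (Suc k)) powr (real r * \<alpha>)) \<longlonglongrightarrow> (\<alpha> / p) ^ r * L * 1 powr (real r * \<alpha>)"
    by (intro tendsto_mult tendsto_const L tendsto_powr LIMSEQ_n_over_Suc_n) auto
  moreover have "\<forall>\<^sub>F k in sequentially. (\<alpha> / p) ^ r * (E k (\<lambda>w d. real w ^ r) / real k powr (real r * \<alpha>))
     * (real k / real (Suc k)) powr (real r * \<alpha>) = E k (\<lambda>w d. (\<alpha> / p * (real w / real (Suc k) powr \<alpha>)) ^ r)"
    using eventually_gt_at_top[of 0]
  proof eventually_elim
    case (elim k)
    have "(\<alpha> / p * (real w / real (Suc k) powr \<alpha>)) ^ r
      = (\<alpha> / p) ^ r / real (Suc k) powr (real r * \<alpha>) * real w ^ r" for w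
      by (simp add: power_divide power_mult_distrib powr_realpow[symmetric] powr_powr mult.commute
          del: of_nat_Suc)
    then have "E k (\<lambda>w d. (\<alpha> / p * (real w / real (Suc k) powr \<alpha>)) ^ r)
      = (\<alpha> / p) ^ r / real (Suc k) powr (real r * \<alpha>) * E k (\<lambda>w d. real w ^ r)"
      by (simp only: E_cmult)
    then show ?case
      using elim by (simp add: powr_divide del: of_nat_Suc)
  qed
  ultimately have "(\<lambda>k. E k (\<lambda>w d. (\<alpha> / p * (real w / real (Suc k) powr \<alpha>)) ^ r)) \<longlonglongrightarrow> (\<alpha> / p) ^ r * L"
    using Lim_transform_eventually by fastforce
  then have "(\<lambda>k. E k (\<lambda>w d. (\<alpha> / p * (real w / real (Suc k) powr \<alpha>)) ^ r)) \<longlonglongrightarrow> \<alpha> / p\<^sup>2 * (fact r / Gamma (real r * \<alpha> + 1))"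
    unfolding L_eq .
  then show ?thesis
    using False unfolding \<alpha>_def by simp
qed

text \<open>\<open>D - p / (2 p - 1) W\<close> is a martingale whose variance is only of the order of \<open>E W\<close>, so that
  \<open>D\<close> and \<open>p / (2 p - 1) W\<close> have the same limit after scaling.\<close>

lemma E_martingale_square:
  assumes "p > 1 / 2"
  obtains C K where "\<And>k. E k (\<lambda>w d. (real d - p / (2 * p - 1) * real w)\<^sup>2) = C + K * E k (\<lambda>w d. real w)"
proof -
  define \<alpha> where "\<alpha> = 2 * p - 1"
  \<comment> \<open>With this c the drift p - c \<alpha> of d - c w vanishes.\<close>
  define c where "c = p / \<alpha>"
  \<comment> \<open>The numerator is the mean square jump of d - c w per unit of weight, and
    \<alpha> is the drift of w, so K w compensates the growth of the square.\<close>
  define K where "K = (p * (1 - c)\<^sup>2 + (1 - p) * c\<^sup>2) / \<alpha>"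
  have \<alpha>: "\<alpha> > 0" using assms by (auto simp: \<alpha>_def)
  have c: "c * \<alpha> = p" "K * \<alpha> = p * (1 - c)\<^sup>2 + (1 - p) * c\<^sup>2"
    using \<alpha> by (auto simp: c_def K_def)
  have "E k (\<lambda>w d. (real d - c * real w)\<^sup>2 - K * real w) = (real 1 - c * real 2)\<^sup>2 - K * real 2" for k
  proof -
    let ?f = "\<lambda>w d. (real d - c * real w)\<^sup>2 - K * real w"
    have "E k ?f = ?f 2 (Suc 0)"
    proof (rule E_invariant)
      fix w d
      show "real w * (p * (?f (w + 1) (d + 1) - ?f w d) + (1 - p) * (?f (w - 1) d - ?f w d)) = 0"
      proof (cases w)
        case (Suc v)
        define M where "M = real d - c * real w"
        have w1: "real (w - 1) = real w - 1" using Suc by simp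
        have "?f (w + 1) (d + 1) - ?f w d = 2 * M * (1 - c) + (1 - c)\<^sup>2 - K"
          by (simp add: M_def power2_eq_square algebra_simps)
        moreover have "?f (w - 1) d - ?f w d = 2 * M * c + c\<^sup>2 + K"
          unfolding w1 by (simp add: M_def power2_eq_square algebra_simps)
        moreover have "p * (2 * M * (1 - c) + (1 - c)\<^sup>2 - K) + (1 - p) * (2 * M * c + c\<^sup>2 + K)
          = 2 * M * (p - c * \<alpha>) + (p * (1 - c)\<^sup>2 + (1 - p) * c\<^sup>2 - K * \<alpha>)"
          by (simp add: \<alpha>_def algebra_simps)
        ultimately show ?thesis by (simp add: c)
      qed simp
    qed
    then show ?thesis by simp
  qed
  then have "E k (\<lambda>w d. (real d - c * real w)\<^sup>2) = ((real 1 - c * real 2)\<^sup>2 - K * real 2) + K * E k (\<lambda>w d. real w)" for k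
    by (simp only: E_diff E_cmult) (simp add: algebra_simps)
  then show ?thesis
    using that unfolding c_def \<alpha>_def by blast
qed

text \<open>The squared mean of the absolute value is at most the second moment, which has order at
  most n powr \<alpha> for \<alpha> = 2 p - 1. Division by the square of n powr \<alpha> sends it to
  0.\<close>

lemma E_abs_martingale_tendsto_0:
  assumes "p > 1 / 2"
  shows "(\<lambda>k. E k (\<lambda>w d. \<bar>real d - p / (2 * p - 1) * real w\<bar>) / real (Suc k) powr (2 * p - 1)) \<longlonglongrightarrow> 0"
proof -
  define \<alpha> where "\<alpha> = 2 * p - 1"
  have \<alpha>: "\<alpha> > 0" using assms by (auto simp: \<alpha>_def)
  define M where "M = (\<lambda>w d. real d - p / \<alpha> * real w)"
  obtain C K where CK: "\<And>k. E k (\<lambda>w d. (M w d)\<^sup>2) = C + K * E k (\<lambda>w d. real w)"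
    using E_martingale_square[OF assms] unfolding M_def \<alpha>_def by metis
  define N where "N k = real (Suc k) powr \<alpha>" for k
  have N: "N k > 0" for k by (simp add: N_def)
  have Ninv: "(\<lambda>k. 1 / N k) \<longlonglongrightarrow> 0"
  proof -
    have "(\<lambda>k. real (Suc k) powr - \<alpha>) \<longlonglongrightarrow> 0"
      using \<alpha> by (intro tendsto_neg_powr filterlim_compose[OF filterlim_real_sequentially filterlim_Suc]) auto
    then show ?thesis by (simp add: N_def powr_minus divide_inverse)
  qed
  have "(\<lambda>k. E k (\<lambda>w d. ((2 * p - 1) / p * (real w / real (Suc k) powr (2 * p - 1))) ^ 1))
    \<longlonglongrightarrow> (2 * p - 1) / p\<^sup>2 * (1 / Gamma (2 * p))"
    using E_power_asymp_supercritical[OF assms, of 1] by simp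
  also have "(\<lambda>k. E k (\<lambda>w d. ((2 * p - 1) / p * (real w / real (Suc k) powr (2 * p - 1))) ^ 1))
    = (\<lambda>k. \<alpha> / p * (E k (\<lambda>w d. real w) / N k))"
  proof
    fix k
    have "((2 * p - 1) / p * (real w / real (Suc k) powr (2 * p - 1))) ^ 1 = \<alpha> / p / N k * real w" for w
      by (simp add: \<alpha>_def N_def)
    then show "E k (\<lambda>w d. ((2 * p - 1) / p * (real w / real (Suc k) powr (2 * p - 1))) ^ 1) = \<alpha> / p * (E k (\<lambda>w d. real w) / N k)"
      by (simp only: E_cmult) simp
  qed
  finally have "(\<lambda>k. p / \<alpha> * (\<alpha> / p * (E k (\<lambda>w d. real w) / N k))) \<longlonglongrightarrow> p / \<alpha> * ((2 * p - 1) / p\<^sup>2 * (1 / Gamma (2 * p)))"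
    by (rule tendsto_mult_left)
  then obtain l where EW: "(\<lambda>k. E k (\<lambda>w d. real w) / N k) \<longlonglongrightarrow> l"
    using \<alpha> p_pos by auto
  have "(\<lambda>k. C * (1 / N k * (1 / N k)) + K * (E k (\<lambda>w d. real w) / N k * (1 / N k))) \<longlonglongrightarrow> C * (0 * 0) + K * (l * 0)"
    by (intro tendsto_intros Ninv EW)
  then have "(\<lambda>k. E k (\<lambda>w d. (M w d)\<^sup>2) / (N k)\<^sup>2) \<longlonglongrightarrow> 0"
    unfolding CK by (simp add: add_divide_distrib power2_eq_square)
  then have lim: "(\<lambda>k. sqrt (E k (\<lambda>w d. (M w d)\<^sup>2) / (N k)\<^sup>2)) \<longlonglongrightarrow> 0"
    using tendsto_real_sqrt by fastforce
  have bound: "norm (E k (\<lambda>w d. \<bar>M w d\<bar>) / N k) \<le> sqrt (E k (\<lambda>w d. (M w d)\<^sup>2) / (N k)\<^sup>2)" for k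
  proof -
    note int = integrable_measure_pmf_finite[OF finite_set_pmf_chain[of k]]
    have "(E k (\<lambda>w d. \<bar>M w d\<bar>))\<^sup>2 \<le> E k (\<lambda>w d. (M w d)\<^sup>2)"
      using measure_pmf.variance_positive[of "chain k" "\<lambda>(w, d). \<bar>M w d\<bar>"]
      by (subst (asm) measure_pmf.variance_eq) (auto simp: int E_def case_prod_unfold)
    then have "(E k (\<lambda>w d. \<bar>M w d\<bar>) / N k)\<^sup>2 \<le> E k (\<lambda>w d. (M w d)\<^sup>2) / (N k)\<^sup>2"
      by (simp add: power_divide divide_right_mono)
    then show ?thesis
      using real_sqrt_le_mono by fastforce
  qed
  have "(\<lambda>k. E k (\<lambda>w d. \<bar>M w d\<bar>) / N k) \<longlonglongrightarrow> 0"
    by (rule Lim_null_comparison[OF always_eventually[OF allI[OF bound]] lim])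
  then show ?thesis
    by (simp add: M_def N_def \<alpha>_def)
qed

text \<open>The method of moments settles the scaled weight, the mean distance to the scaled degree
  vanishes, and Levy's continuity theorem turns convergence of characteristic functions into weak
  convergence.\<close>

lemma source_degree_converges_supercritical:
  assumes "1 / 2 < p"
  shows "\<exists>(M :: (real \<times> real) measure) (B :: real \<times> real \<Rightarrow> real) (Y :: real \<times> real \<Rightarrow> real).
    prob_space M \<and>
    prob_space.indep_var M borel B borel Y \<and>
    distr M borel B = distr (bernoulli_pmf ((2 * p - 1) / p\<^sup>2)) borel of_bool \<and>
    mittag_leffler (2 * p - 1) (distr M borel Y) \<and>
    weak_conv_m
      (\<lambda>n. distr (source_degree_pmf p n) borel
              (\<lambda>d. (2 * p - 1)\<^sup>2 / p\<^sup>2 * (real d / real n powr (2 * p - 1))))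
      (distr M borel (\<lambda>\<omega>. B \<omega> * Y \<omega>))"
proof -
  define \<alpha> where "\<alpha> = 2 * p - 1"
  define \<beta> where "\<beta> = \<alpha> / p\<^sup>2"
  have \<alpha>: "0 < \<alpha>" "\<alpha> < 1" using assms p_less_1 by (auto simp: \<alpha>_def)
  \<comment> \<open>This says 2 p - 1 \<le> p^2, so that \<beta> is a probability.\<close>
  have "0 \<le> (p - 1)\<^sup>2" by simp
  then have \<beta>: "0 \<le> \<beta>" "\<beta> \<le> 1"
    using \<alpha> p_pos by (auto simp: \<beta>_def \<alpha>_def field_simps power2_eq_square)
  obtain \<nu> where \<nu>: "mittag_leffler \<alpha> \<nu>"
    using mittag_leffler_exists[OF \<alpha>] .
  define Bd where "Bd = distr (bernoulli_pmf \<beta>) borel (of_bool :: bool \<Rightarrow> real)"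
  have Bd: "real_distribution Bd"
    unfolding Bd_def by (intro prob_space.real_distribution_distr prob_space_measure_pmf) simp
  define M where "M = Bd \<Otimes>\<^sub>M \<nu>"
  note prod = real_distributions_product[OF Bd, of \<nu>, folded M_def]
  have nu_dist: "real_distribution \<nu>" using \<nu> by (simp add: mittag_leffler_def)
  interpret M: prob_space M using prod(1)[OF nu_dist] .
  have fst: "distr M borel fst = Bd" and snd: "distr M borel snd = \<nu>"
    and ind: "M.indep_var borel fst borel snd"
    using prod nu_dist by auto
  have rv: "fst \<in> borel_measurable M" "snd \<in> borel_measurable M"
    using ind M.indep_var_rv1 M.indep_var_rv2 by blast+
  have int_B: "integrable M (\<lambda>\<omega>. fst \<omega> ^ r)"
    and mom_B: "(\<integral>\<omega>. fst \<omega> ^ r \<partial>M) = (if r = 0 then 1 else \<beta>)" for r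
  proof -
    have "integrable Bd (\<lambda>x. x ^ r)"
      unfolding Bd_def by (simp add: integrable_distr_eq integrable_measure_pmf_finite)
    then show "integrable M (\<lambda>\<omega>. fst \<omega> ^ r)"
      using rv unfolding fst[symmetric] by (simp add: integrable_distr_eq)
    have "(\<integral>x. x ^ r \<partial>Bd) = (if r = 0 then 1 else \<beta>)"
      unfolding Bd_def using \<beta> by (simp add: integral_distr)
    then show "(\<integral>\<omega>. fst \<omega> ^ r \<partial>M) = (if r = 0 then 1 else \<beta>)"
      using rv unfolding fst[symmetric] by (simp add: integral_distr)
  qed
  have int_Y: "integrable M (\<lambda>\<omega>. snd \<omega> ^ r)"
    and mom_Y: "(\<integral>\<omega>. snd \<omega> ^ r \<partial>M) = fact r / Gamma (real r * \<alpha> + 1)" for r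
  proof -
    have "has_bochner_integral (distr M borel snd) (\<lambda>x. x ^ r) (fact r / Gamma (real r * \<alpha> + 1))"
      using \<nu> unfolding snd mittag_leffler_def by blast
    then show "integrable M (\<lambda>\<omega>. snd \<omega> ^ r)" "(\<integral>\<omega>. snd \<omega> ^ r \<partial>M) = fact r / Gamma (real r * \<alpha> + 1)"
      using rv by (simp_all add: has_bochner_integral_iff integrable_distr_eq integral_distr)
  qed
  define Q where "Q = distr M borel (\<lambda>\<omega>. fst \<omega> * snd \<omega>)"
  note Q = moments_of_product[OF M.prob_space_axioms ind int_B int_Y, folded Q_def]
  have mom_Q: "(\<integral>x. x ^ r \<partial>Q) = (if r = 0 then 1 else \<beta>) * (fact r / Gamma (real r * \<alpha> + 1))" for r
    by (simp only: Q(3) mom_B mom_Y)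
  \<comment> \<open>As D is close to (p / \<alpha>) W, the factor \<alpha>^2 / p^2 for D corresponds
    to \<alpha> / p for W.\<close>
  define X where "X k = (\<lambda>(w::nat, d::nat). \<alpha> / p * (real w / real (Suc k) powr \<alpha>))" for k
  define D where "D k = (\<lambda>(w::nat, d::nat). \<alpha>\<^sup>2 / p\<^sup>2 * (real d / real (Suc k) powr \<alpha>))" for k
  have char_X: "(\<lambda>k. char (distr (chain k) borel (X k)) t) \<longlonglongrightarrow> char Q t" for t
  proof (rule char_tendsto_of_moments[OF _ Q(1) _ Q(2)])
    show "real_distribution (distr (chain k) borel (X k))" for k
      unfolding X_def by (rule distr_chain)
    show "integrable (distr (chain k) borel (X k)) (\<lambda>x. x ^ r)" for k r
      unfolding X_def by (rule distr_chain)
    show "(\<lambda>k. \<integral>x. x ^ r \<partial>distr (chain k) borel (X k)) \<longlonglongrightarrow> (\<integral>x. x ^ r \<partial>Q)" for r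
      unfolding X_def distr_chain mom_Q \<beta>_def \<alpha>_def by (rule E_power_asymp_supercritical[OF assms])
    show "(\<lambda>r. t ^ r * (\<integral>x. x ^ r \<partial>Q) / fact r) \<longlonglongrightarrow> 0" for t
    proof -
      have "(\<lambda>r. \<beta> * (t ^ r / Gamma (real r * \<alpha> + 1))) \<longlonglongrightarrow> \<beta> * 0"
        by (intro tendsto_mult tendsto_const power_over_Gamma_tendsto_0 \<alpha>)
      moreover have "\<forall>\<^sub>F r in sequentially. \<beta> * (t ^ r / Gamma (real r * \<alpha> + 1)) = t ^ r * (\<integral>x. x ^ r \<partial>Q) / fact r"
        using eventually_gt_at_top[of 0] by eventually_elim (simp add: mom_Q)
      ultimately show ?thesis
        using Lim_transform_eventually by fastforce
    qed
  qed
  have diff: "(\<lambda>k. char (distr (chain k) borel (D k)) t - char (distr (chain k) borel (X k)) t) \<longlonglongrightarrow> 0" for t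
  proof (rule char_pmf_diff_tendsto_0[OF finite_set_pmf_chain])
    have "(\<lambda>k. \<alpha>\<^sup>2 / p\<^sup>2 * (E k (\<lambda>w d. \<bar>real d - p / \<alpha> * real w\<bar>) / real (Suc k) powr \<alpha>)) \<longlonglongrightarrow> \<alpha>\<^sup>2 / p\<^sup>2 * 0"
      using E_abs_martingale_tendsto_0[OF assms] unfolding \<alpha>_def by (intro tendsto_mult tendsto_const)
    also have "(\<lambda>k. \<alpha>\<^sup>2 / p\<^sup>2 * (E k (\<lambda>w d. \<bar>real d - p / \<alpha> * real w\<bar>) / real (Suc k) powr \<alpha>))
      = (\<lambda>k. measure_pmf.expectation (chain k) (\<lambda>s. \<bar>D k s - X k s\<bar>))"
    proof
      fix k
      have "\<bar>D k (w, d) - X k (w, d)\<bar> = \<alpha>\<^sup>2 / p\<^sup>2 / real (Suc k) powr \<alpha> * \<bar>real d - p / \<alpha> * real w\<bar>" for w d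
      proof -
        have "D k (w, d) - X k (w, d) = \<alpha>\<^sup>2 / p\<^sup>2 / real (Suc k) powr \<alpha> * (real d - p / \<alpha> * real w)"
          using \<alpha> p_pos by (simp add: D_def X_def field_simps power2_eq_square del: of_nat_Suc)
        then show ?thesis by (simp only: abs_mult) simp
      qed
      then have "measure_pmf.expectation (chain k) (\<lambda>s. \<bar>D k s - X k s\<bar>)
        = E k (\<lambda>w d. \<alpha>\<^sup>2 / p\<^sup>2 / real (Suc k) powr \<alpha> * \<bar>real d - p / \<alpha> * real w\<bar>)"
        unfolding E_def by (intro arg_cong[of _ _ "integral\<^sup>L _"]) auto
      then show "\<alpha>\<^sup>2 / p\<^sup>2 * (E k (\<lambda>w d. \<bar>real d - p / \<alpha> * real w\<bar>) / real (Suc k) powr \<alpha>)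
        = measure_pmf.expectation (chain k) (\<lambda>s. \<bar>D k s - X k s\<bar>)"
        by (simp only: E_cmult) simp
    qed
    finally show "(\<lambda>k. measure_pmf.expectation (chain k) (\<lambda>s. \<bar>D k s - X k s\<bar>)) \<longlonglongrightarrow> 0" by simp
  qed
  define S where "S n = distr (source_degree_pmf p n) borel (\<lambda>d. \<alpha>\<^sup>2 / p\<^sup>2 * (real d / real n powr \<alpha>))" for n
  have S_Suc: "S (Suc k) = distr (chain k) borel (D k)" for k
    unfolding S_def source_degree_pmf_eq map_pmf_rep_eq D_def
    by (subst distr_distr) (auto simp: comp_def case_prod_unfold)
  have "weak_conv_m S Q"
  proof (rule levy_continuity[OF _ Q(1)])
    show "real_distribution (S n)" for n
      unfolding S_def by (intro prob_space.real_distribution_distr prob_space_measure_pmf) simp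
    show "(\<lambda>n. char (S n) t) \<longlonglongrightarrow> char Q t" for t
    proof (rule LIMSEQ_imp_Suc)
      have "(\<lambda>k. (char (distr (chain k) borel (D k)) t - char (distr (chain k) borel (X k)) t)
         + char (distr (chain k) borel (X k)) t) \<longlonglongrightarrow> 0 + char Q t"
        by (intro tendsto_add diff char_X)
      then show "(\<lambda>k. char (S (Suc k)) t) \<longlonglongrightarrow> char Q t" by (simp add: S_Suc)
    qed
  qed
  then show ?thesis
    using M.prob_space_axioms ind fst snd \<nu> unfolding Q_def S_def Bd_def \<beta>_def \<alpha>_def by blast
qed

end

theorem theorem9:
  fixes p :: real
  assumes "0 < p" and "p < 1"
  shows "(p \<le> 1 / 2 \<longrightarrow>
           (\<exists>D :: nat pmf.
              (\<forall>m\<ge>1. pmf D m = 1 / (real m + 1) * real ((2 * m) choose m) * p ^ (m - 1) * (1 - p) ^ (m + 1)) \<and>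
              weak_conv_m (\<lambda>n. distr (source_degree_pmf p n) borel real) (distr D borel real))) \<and>
         (1 / 2 < p \<longrightarrow>
           (\<exists>(M :: (real \<times> real) measure) (B :: real \<times> real \<Rightarrow> real) (Y :: real \<times> real \<Rightarrow> real).
              prob_space M \<and>
              prob_space.indep_var M borel B borel Y \<and>
              distr M borel B = distr (bernoulli_pmf ((2 * p - 1) / p\<^sup>2)) borel of_bool \<and>
              mittag_leffler (2 * p - 1) (distr M borel Y) \<and>
              weak_conv_m
                (\<lambda>n. distr (source_degree_pmf p n) borel
                        (\<lambda>d. (2 * p - 1)\<^sup>2 / p\<^sup>2 * (real d / real n powr (2 * p - 1))))
                (distr M borel (\<lambda>\<omega>. B \<omega> * Y \<omega>))))"
proof -
  interpret saturation p using assms by unfold_locales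
  show ?thesis
    using source_degree_converges_subcritical source_degree_converges_supercritical by blast
qed

end
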